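(* Let $K$ be a field, let $r,s\ge 1$ be integers, $A=K[x_1,\ldots,x_r]$, $B=K[x_{r+1},\ldots,x_{r+s}]$ and $R=K[x_1,\ldots,x_{r+s}]$. Let $I\subset A$ and $J\subset B$ be nonzero proper monomial ideals. (1) If $\operatorname{sdepth}_R(R/(I^2+IJ))<\operatorname{sdepth}_A(A/I)+\operatorname{sdepth}_B(J^2)$, then $$\operatorname{sdepth}_R(R/(I+J)^2)\le\operatorname{sdepth}_A(A/I)+\operatorname{sdepth}_B(J^2).$$ (2) If $\operatorname{sdepth}_R(R/I^2)<\operatorname{sdepth}_A(I/I^2)+\operatorname{sdepth}_B(J)$, then $$\operatorname{sdepth}_R(R/(I^2+IJ))\le\operatorname{sdepth}_R(R/I^2),$$ and moreover $\operatorname{sdepth}_A(A/I)\le\operatorname{sdepth}_A(A/I^2)$.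
   Context: The symbols $I$, $J$ also denote the extended ideals $IR$, $JR$ in $R$; inside $\operatorname{sdepth}_R$ all ideals are ideals of $R$ (so $R/I^2=R/(IR)^2$), while $\operatorname{sdepth}_A$, $\operatorname{sdepth}_B$ refer to the original ideals in $A$, $B$. Stanley depth: let $S$ be a polynomial ring over $K$ in $N$ variables $x_1,\ldots,x_N$ and let $M$ be a finitely generated $\mathbb Z^N$-graded $S$-module. A Stanley decomposition of $M$ is a finite direct sum decomposition $\mathcal D: M=\bigoplus_{i=1}^{q} m_iK[Z_i]$ as a $\mathbb Z^N$-graded $K$-vector space, where each $m_i\in M$ is homogeneous, $Z_i\subset\{x_1,\ldots,x_N\}$, and $m_iK[Z_i]=\{um_i: u\in K[Z_i]\}$ is a free $K[Z_i]$-submodule of $M$. Put $\operatorname{sdepth}(\mathcal D)=\min_i|Z_i|$ and let $\operatorname{sdepth}_S(M)$ be the maximum of $\operatorname{sdepth}(\mathcal D)$ over all Stanley decompositions $\mathcal D$ of $M$. *)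

theory Defs
  imports
    "HOL-Library.Poly_Mapping"
    "HOL-Algebra.Module"
    "HOL-Algebra.QuotRing"
    "HOL-Algebra.Ideal_Product"
begin

text \<open>
  Variables are indexed by natural numbers; for a set \<open>V\<close> of indices, \<open>mpoly_ring V\<close> is the
  polynomial ring over the field \<open>'k\<close> in the variables \<open>x\<^sub>v\<close> with \<open>v \<in> V\<close>. For \<open>V \<subseteq> V'\<close> the
  ring \<open>mpoly_ring V\<close> is literally a subring of \<open>mpoly_ring V'\<close>.
\<close>

type_synonym 'k mpoly = "(nat \<Rightarrow>\<^sub>0 nat) \<Rightarrow>\<^sub>0 'k"

definition mpoly_ring :: "nat set \<Rightarrow> 'k::field mpoly ring" where
  "mpoly_ring V =
     \<lparr>carrier = {p. \<forall>t\<in>Poly_Mapping.keys p. Poly_Mapping.keys t \<subseteq> V},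
      mult = (*), one = 1, zero = 0, add = (+)\<rparr>"

definition monomials :: "nat set \<Rightarrow> 'k::field mpoly set" where
  "monomials V = {Poly_Mapping.single t 1 | t. Poly_Mapping.keys t \<subseteq> V}"

definition monomial_ideal :: "nat set \<Rightarrow> 'k::field mpoly set \<Rightarrow> bool" where
  "monomial_ideal V I \<longleftrightarrow> (\<exists>G \<subseteq> monomials V. I = Idl\<^bsub>mpoly_ring V\<^esub> G)"

text \<open>
  A module together with a family of homogeneous components. Multidegrees in \<open>\<int>\<^sup>V\<close> are
  represented by functions \<open>nat \<Rightarrow> int\<close> that vanish outside \<open>V\<close>.
\<close>

record ('a, 'm) graded_module = "('a, 'm) module" +
  hcomp :: "(nat \<Rightarrow> int) \<Rightarrow> 'm set"

definition multidegrees :: "nat set \<Rightarrow> (nat \<Rightarrow> int) set" where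
  "multidegrees V = {\<alpha>. \<forall>v. v \<notin> V \<longrightarrow> \<alpha> v = 0}"

text \<open>
  A monomial ideal \<open>U\<close> as a graded module. The fields \<open>mult\<close> and \<open>one\<close>, which the record type of
  modules inherits from rings, play no role for modules.
\<close>

definition ideal_module :: "'k::field mpoly set \<Rightarrow> ('k mpoly, 'k mpoly) graded_module" where
  "ideal_module U =
     \<lparr>carrier = U, mult = undefined, one = undefined, zero = 0, add = (+), smult = (*),
      hcomp = (\<lambda>\<alpha>. {u \<in> U. \<forall>t\<in>Poly_Mapping.keys u. \<forall>v. int (Poly_Mapping.lookup t v) = \<alpha> v})\<rparr>"

text \<open>The quotient of \<open>M\<close> by a graded submodule with underlying set \<open>W\<close>; its elements are cosets.\<close>

definition quotient_module ::
  "('a, 'm) graded_module \<Rightarrow> 'm set \<Rightarrow> ('a, 'm set) graded_module" where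
  "quotient_module M W =
     \<lparr>carrier = (\<lambda>m. W +>\<^bsub>M\<^esub> m) ` carrier M, mult = undefined, one = undefined,
      zero = W, add = set_add M, smult = (\<lambda>p C. \<Union>c\<in>C. W +>\<^bsub>M\<^esub> (p \<odot>\<^bsub>M\<^esub> c)),
      hcomp = (\<lambda>\<alpha>. (\<lambda>m. W +>\<^bsub>M\<^esub> m) ` hcomp M \<alpha>)\<rparr>"

definition stanley_space ::
  "('k::field mpoly, 'm) graded_module \<Rightarrow> 'm \<Rightarrow> nat set \<Rightarrow> 'm set" where
  "stanley_space M m Z = {u \<odot>\<^bsub>M\<^esub> m | u. u \<in> carrier (mpoly_ring Z)}"

text \<open>
  Stanley decomposition \<open>M = (m\<^sub>1 K[Z\<^sub>1]) \<oplus> \<dots> \<oplus> (m\<^sub>q K[Z\<^sub>q])\<close>. Freeness of \<open>m\<^sub>i K[Z\<^sub>i]\<close> means that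
  \<open>m\<^sub>i\<close> has no nonzero annihilator in \<open>K[Z\<^sub>i]\<close>; the direct sum is expressed by existence and
  uniqueness of the components of every element of \<open>M\<close>. Since the \<open>m\<^sub>i\<close> are homogeneous, the
  summands are graded subspaces.
\<close>

definition stanley_decomposition ::
  "nat set \<Rightarrow> ('k::field mpoly, 'm) graded_module \<Rightarrow> nat \<Rightarrow> (nat \<Rightarrow> 'm) \<Rightarrow> (nat \<Rightarrow> nat set) \<Rightarrow> bool"
  where
  "stanley_decomposition V M q m Z \<longleftrightarrow>
     (\<forall>i\<in>{1..q}.
        m i \<in> carrier M \<and> (\<exists>\<alpha>\<in>multidegrees V. m i \<in> hcomp M \<alpha>) \<and> Z i \<subseteq> V \<and>
        (\<forall>u\<in>carrier (mpoly_ring (Z i)). u \<odot>\<^bsub>M\<^esub> m i = \<zero>\<^bsub>M\<^esub> \<longrightarrow> u = 0)) \<and>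
     (\<forall>w\<in>carrier M.
        \<exists>!f. f \<in> (\<Pi>\<^sub>E i\<in>{1..q}. stanley_space M (m i) (Z i)) \<and> w = finsum M f {1..q})"

text \<open>
  For a finite set \<open>V\<close> of variables and a nonzero module every Stanley decomposition has at least
  one summand, so the minimum is over a nonempty set and the maximum is over a set of numbers that
  are at most \<open>card V\<close>. The value for the zero module is not meaningful.
\<close>

definition sdepth :: "nat set \<Rightarrow> ('k::field mpoly, 'm) graded_module \<Rightarrow> nat" where
  "sdepth V M = Max {Min ((\<lambda>i. card (Z i)) ` {1..q}) | q m Z. stanley_decomposition V M q m Z}"

end

theory Submission
  imports Defs "HOL-Library.Set_Algebras" "HOL-Library.Disjoint_Sets"
begin

text \<open>
  For monomial ideals \<open>W \<subseteq> U\<close> every homogeneous component of \<open>U/W\<close> is at most one-dimensional,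
  so a Stanley decomposition of \<open>U/W\<close> is the same thing as a partition of the set of exponents
  of monomials in \<open>U - W\<close> into finitely many cones \<open>a + \<nat>\<^sup>Z\<close>. Cone partitions of disjoint sets can
  be united, and cone partitions of sets of exponents in disjoint sets of variables can be added
  (the sizes of the sets \<open>Z\<close> add up). Hence the theorem reduces to the partitions
  \<open>R/(I\<^sup>2+IJ) = R/(I+J)\<^sup>2 \<union> (A/I) \<cdot> J\<^sup>2\<close>, \<open>R/I\<^sup>2 = R/(I\<^sup>2+IJ) \<union> (I/I\<^sup>2) \<cdot> J\<close> and \<open>A/I\<^sup>2 = A/I \<union> I/I\<^sup>2\<close>
  of monomials, together with \<open>sdepth (A/I\<^sup>2) + s \<le> sdepth (R/I\<^sup>2)\<close> and \<open>sdepth J \<le> s\<close>. The maximum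
  in the definition of \<open>sdepth\<close> is attained because every difference of two monomial ideals has
  a cone partition.
\<close>

section \<open>Partitions into cones\<close>

definition exps :: "nat set \<Rightarrow> (nat \<Rightarrow>\<^sub>0 nat) set" where
  "exps V = {t. Poly_Mapping.keys t \<subseteq> V}"

text \<open>These are the exponent sets of the monomial ideals of the polynomial ring in the
  variables \<open>V\<close>; the empty set stands for the zero ideal.\<close>

definition upset :: "nat set \<Rightarrow> (nat \<Rightarrow>\<^sub>0 nat) set \<Rightarrow> bool" where
  "upset V E \<longleftrightarrow> E \<subseteq> exps V \<and> E + exps V \<subseteq> E"

text \<open>A pair consists of an apex and a set of free directions; its cone collects the exponents
  of the monomials of the Stanley space x^a K[Z].\<close>

definition cone :: "(nat \<Rightarrow>\<^sub>0 nat) \<times> nat set \<Rightarrow> (nat \<Rightarrow>\<^sub>0 nat) set" where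
  "cone p = fst p +o exps (snd p)"

text \<open>Cones are nonempty, so disjoint cones have distinct pairs, and a set of pairs records as
  much as an indexed family.\<close>

definition cone_decomp ::
  "nat set \<Rightarrow> (nat \<Rightarrow>\<^sub>0 nat) set \<Rightarrow> ((nat \<Rightarrow>\<^sub>0 nat) \<times> nat set) set \<Rightarrow> bool" where
  "cone_decomp V T D \<longleftrightarrow>
     finite D \<and> (\<forall>p\<in>D. snd p \<subseteq> V) \<and> disjoint_family_on cone D \<and> (\<Union>p\<in>D. cone p) = T"

text \<open>A lower bound takes the place of a maximum: for nonempty differences of upsets the
  Stanley depth is the largest such \<open>k\<close>, while the empty set admits every
  \<open>k\<close>.\<close>

definition has_depth :: "nat set \<Rightarrow> (nat \<Rightarrow>\<^sub>0 nat) set \<Rightarrow> nat \<Rightarrow> bool" where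
  "has_depth V T k \<longleftrightarrow> (\<exists>D. cone_decomp V T D \<and> (\<forall>p\<in>D. k \<le> card (snd p)))"

section \<open>Exponent vectors and their sum sets\<close>

lemma keys_add_nat:
  fixes s t :: "nat \<Rightarrow>\<^sub>0 nat"
  shows "Poly_Mapping.keys (s + t) = Poly_Mapping.keys s \<union> Poly_Mapping.keys t"
  by (auto simp: in_keys_iff lookup_add)

lemma zero_in_exps [simp]: "0 \<in> exps V"
  by (simp add: exps_def)

lemma exps_add_iff [simp]: "s + t \<in> exps V \<longleftrightarrow> s \<in> exps V \<and> t \<in> exps V"
  by (simp add: exps_def keys_add_nat)

lemma exps_mono: "V \<subseteq> V' \<Longrightarrow> exps V \<subseteq> exps V'"
  by (auto simp: exps_def)

lemma lookup_exps: "t \<in> exps V \<Longrightarrow> v \<notin> V \<Longrightarrow> Poly_Mapping.lookup t v = 0"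
  by (auto simp: exps_def in_keys_iff)

lemma single_in_exps [simp]: "Poly_Mapping.single v n \<in> exps V \<longleftrightarrow> n = 0 \<or> v \<in> V"
  by (simp add: exps_def)

lemma exps_Un: "exps (V \<union> W) = exps V + exps W"
proof
  show "exps (V \<union> W) \<subseteq> exps V + exps W"
  proof
    fix t assume t: "t \<in> exps (V \<union> W)"
    \<comment> \<open>The part of \<open>t\<close> with indices in \<open>X\<close>. Cutting along
      \<open>V\<close> and its complement, rather than along \<open>V\<close> and \<open>W\<close>,
      avoids counting an overlap twice.\<close>
    let ?P = "\<lambda>X. \<Sum>v\<in>Poly_Mapping.keys t \<inter> X. Poly_Mapping.single v (Poly_Mapping.lookup t v)"
    have *: "Poly_Mapping.lookup (?P X) w = (if w \<in> X then Poly_Mapping.lookup t w else 0)" for X w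
      by (auto simp: lookup_sum lookup_single when_def in_keys_iff sum.delta)
    have "t = ?P V + ?P (- V)"
      by (rule poly_mapping_eqI) (simp only: lookup_add *, simp)
    moreover have "?P V \<in> exps V" "?P (- V) \<in> exps W"
    proof -
      have "w \<in> V" if "w \<in> Poly_Mapping.keys (?P V)" for w
        using that by (metis * in_keys_iff)
      moreover have "w \<in> W" if "w \<in> Poly_Mapping.keys (?P (- V))" for w
        using that t unfolding exps_def in_keys_iff[of w "?P (- V)"] *
        by (metis (mono_tags) ComplD UnE in_keys_iff mem_Collect_eq subsetD)
      ultimately show "?P V \<in> exps V" "?P (- V) \<in> exps W"
        unfolding exps_def by blast+
    qed
    ultimately show "t \<in> exps V + exps W"
      by (metis set_plus_intro)
  qed
  show "exps V + exps W \<subseteq> exps (V \<union> W)"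
    by (auto simp: set_plus_def exps_def keys_add_nat)
qed

lemma exps_add_self [simp]: "exps V + exps V = exps V"
  by (metis exps_Un sup.idem)

text \<open>Each coordinate of the sum comes from one summand alone, because the other vanishes
  there.\<close>

lemma exps_add_inject:
  assumes "V \<inter> W = {}" "s \<in> exps V" "s' \<in> exps V" "t \<in> exps W" "t' \<in> exps W"
    and "s + t = s' + t'"
  shows "s = s' \<and> t = t'"
proof -
  have "Poly_Mapping.lookup s v = Poly_Mapping.lookup s' v \<and>
      Poly_Mapping.lookup t v = Poly_Mapping.lookup t' v" for v
  proof -
    have "Poly_Mapping.lookup s v + Poly_Mapping.lookup t v
        = Poly_Mapping.lookup s' v + Poly_Mapping.lookup t' v"
      using assms(6) by (metis lookup_add)
    then show ?thesis
      using assms(1) lookup_exps[OF assms(2)] lookup_exps[OF assms(3)]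
        lookup_exps[OF assms(4)] lookup_exps[OF assms(5)]
      by (cases "v \<in> V"; cases "v \<in> W") auto
  qed
  then show ?thesis
    by (metis poly_mapping_eqI)
qed

lemma in_cone: "t \<in> cone (a, Z) \<longleftrightarrow> (\<exists>u\<in>exps Z. t = a + u)"
  by (auto simp: cone_def elt_set_plus_def)

lemma apex_in_cone: "fst p \<in> cone p"
  by (cases p) (force simp: in_cone)

section \<open>Unions and sums of cone partitions\<close>

lemma has_depth_mono:
  assumes "has_depth V T k" "V \<subseteq> V'" "l \<le> k"
  shows "has_depth V' T l"
proof -
  obtain D where D: "cone_decomp V T D" "\<forall>p\<in>D. k \<le> card (snd p)"
    using assms(1) by (auto simp: has_depth_def)
  have "cone_decomp V' T D"
    using D(1) assms(2) unfolding cone_decomp_def by (meson subset_trans)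
  moreover have "\<forall>p\<in>D. l \<le> card (snd p)"
    using D(2) assms(3) by (meson order.trans)
  ultimately show ?thesis
    unfolding has_depth_def by blast
qed

lemma has_depth_empty: "has_depth V {} k"
  unfolding has_depth_def cone_decomp_def by (intro exI[of _ "{}"]) (auto simp: disjoint_family_on_def)

lemma has_depth_cone: "Z \<subseteq> V \<Longrightarrow> has_depth V (cone (a, Z)) (card Z)"
  unfolding has_depth_def cone_decomp_def
  by (intro exI[of _ "{(a, Z)}"]) (auto simp: disjoint_family_on_def)

lemma has_depth_exps: "has_depth V (exps V) (card V)"
proof -
  have "cone (0, V) = exps V"
    by (auto simp: in_cone)
  with has_depth_cone[of V V 0] show ?thesis
    by simp
qed

lemma has_depth_Un:
  assumes "has_depth V T k" "has_depth V T' k" "T \<inter> T' = {}"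
  shows "has_depth V (T \<union> T') k"
proof -
  obtain D where D: "cone_decomp V T D" "\<forall>p\<in>D. k \<le> card (snd p)"
    using assms(1) by (auto simp: has_depth_def)
  obtain D' where D': "cone_decomp V T' D'" "\<forall>p\<in>D'. k \<le> card (snd p)"
    using assms(2) by (auto simp: has_depth_def)
  have "disjoint_family_on cone (D \<union> D')"
    unfolding disjoint_family_on_def
  proof (intro ballI impI)
    fix p q assume pq: "p \<in> D \<union> D'" "q \<in> D \<union> D'" "p \<noteq> q"
    have sub: "\<And>p. p \<in> D \<Longrightarrow> cone p \<subseteq> T" "\<And>p. p \<in> D' \<Longrightarrow> cone p \<subseteq> T'"
      using D(1) D'(1) by (auto simp: cone_decomp_def)
    consider "p \<in> D" "q \<in> D" | "p \<in> D'" "q \<in> D'" | "p \<in> D" "q \<in> D'" | "p \<in> D'" "q \<in> D"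
      using pq by blast
    then show "cone p \<inter> cone q = {}"
    proof cases
      case 1
      then show ?thesis
        using D(1) pq(3) by (auto simp: cone_decomp_def disjoint_family_on_def)
    next
      case 2
      then show ?thesis
        using D'(1) pq(3) by (auto simp: cone_decomp_def disjoint_family_on_def)
    qed (use sub assms(3) in blast)+
  qed
  then have "cone_decomp V (T \<union> T') (D \<union> D')"
    using D(1) D'(1) by (auto simp: cone_decomp_def)
  then show ?thesis
    using D(2) D'(2) unfolding has_depth_def by blast
qed

lemma cone_add:
  "cone (a, Z) + cone (b, W) = cone (a + b, Z \<union> W)"
  unfolding cone_def by (simp add: set_plus_rearrange exps_Un)

lemma UN_set_plus: "(\<Union>p\<in>P. f p) + (\<Union>q\<in>Q. g q) = (\<Union>p\<in>P. \<Union>q\<in>Q. f p + g q)"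
  unfolding set_plus_def by blast

text \<open>Adding a cone of one partition to a cone of the other gives a cone whose directions are
  the disjoint union of theirs. Unique splitting of exponents along \<open>V\<close> and
  \<open>W\<close> keeps these cones disjoint. In terms of modules, this is superadditivity of
  Stanley depth under tensor products over the field.\<close>

lemma has_depth_add:
  assumes fin: "finite V" "finite W" and VW: "V \<inter> W = {}"
    and T: "has_depth V T k" "T \<subseteq> exps V" and T': "has_depth W T' l" "T' \<subseteq> exps W"
  shows "has_depth (V \<union> W) (T + T') (k + l)"
proof -
  obtain D where D: "cone_decomp V T D" "\<forall>p\<in>D. k \<le> card (snd p)"
    using T(1) by (auto simp: has_depth_def)
  obtain D' where D': "cone_decomp W T' D'" "\<forall>p\<in>D'. l \<le> card (snd p)"
    using T'(1) by (auto simp: has_depth_def)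
  define f :: "((nat \<Rightarrow>\<^sub>0 nat) \<times> nat set) \<times> ((nat \<Rightarrow>\<^sub>0 nat) \<times> nat set) \<Rightarrow> _"
    where "f = (\<lambda>(p, q). (fst p + fst q, snd p \<union> snd q))"
  have cf: "cone (f (p, q)) = cone p + cone q" for p q
    using cone_add[of "fst p" "snd p" "fst q" "snd q"] by (simp add: f_def)
  have sub: "cone p \<subseteq> T" if "p \<in> D" for p
    using D(1) that by (auto simp: cone_decomp_def)
  have sub': "cone p \<subseteq> T'" if "p \<in> D'" for p
    using D'(1) that by (auto simp: cone_decomp_def)
  \<comment> \<open>A common point splits uniquely into its \<open>V\<close>-part and its
    \<open>W\<close>-part, and each part lies in only one cone of its partition.\<close>
  have disj: "p = p' \<and> q = q'"
    if x: "x \<in> cone (f (p, q))" "x \<in> cone (f (p', q'))"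
      and mem: "p \<in> D" "p' \<in> D" "q \<in> D'" "q' \<in> D'" for x p q p' q'
  proof -
    obtain s t where st: "s \<in> cone p" "t \<in> cone q" "x = s + t"
      using x(1) unfolding cf by (auto elim: set_plus_elim)
    obtain s' t' where st': "s' \<in> cone p'" "t' \<in> cone q'" "x = s' + t'"
      using x(2) unfolding cf by (auto elim: set_plus_elim)
    have "s = s' \<and> t = t'"
    proof (rule exps_add_inject[OF VW])
      show "s \<in> exps V" "s' \<in> exps V" "t \<in> exps W" "t' \<in> exps W"
        using st st' sub sub' mem T(2) T'(2) by blast+
      show "s + t = s' + t'"
        using st st' by simp
    qed
    then show ?thesis
      using st st' mem D(1) D'(1) unfolding cone_decomp_def disjoint_family_on_def by blast
  qed
  have "cone_decomp (V \<union> W) (T + T') (f ` (D \<times> D'))"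
    unfolding cone_decomp_def
  proof (intro conjI)
    show "finite (f ` (D \<times> D'))"
      using D(1) D'(1) by (simp add: cone_decomp_def)
    show "\<forall>p\<in>f ` (D \<times> D'). snd p \<subseteq> V \<union> W"
      using D(1) D'(1) by (fastforce simp: cone_decomp_def f_def)
    show "disjoint_family_on cone (f ` (D \<times> D'))"
      unfolding disjoint_family_on_def
    proof (intro ballI impI)
      fix r r' assume r: "r \<in> f ` (D \<times> D')" "r' \<in> f ` (D \<times> D')" "r \<noteq> r'"
      obtain p q p' q' where "r = f (p, q)" "r' = f (p', q')" "p \<in> D" "p' \<in> D" "q \<in> D'" "q' \<in> D'"
        using r(1,2) by auto
      with disj[of _ p q p' q'] r(3) show "cone r \<inter> cone r' = {}"
        by auto
    qed
    have "T + T' = (\<Union>p\<in>D. cone p) + (\<Union>q\<in>D'. cone q)"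
      using D(1) D'(1) by (simp add: cone_decomp_def)
    also have "\<dots> = (\<Union>p\<in>D. \<Union>q\<in>D'. cone p + cone q)"
      by (rule UN_set_plus)
    also have "\<dots> = (\<Union>p\<in>f ` (D \<times> D'). cone p)"
      unfolding cf[symmetric] by blast
    finally show "(\<Union>p\<in>f ` (D \<times> D'). cone p) = T + T'"
      by simp
  qed
  moreover have "k + l \<le> card (snd r)" if "r \<in> f ` (D \<times> D')" for r
  proof -
    obtain p q where pq: "p \<in> D" "q \<in> D'" "r = f (p, q)"
      using \<open>r \<in> f ` (D \<times> D')\<close> by auto
    have s: "snd p \<subseteq> V" "snd q \<subseteq> W"
      using pq D(1) D'(1) by (auto simp: cone_decomp_def)
    have "card (snd p \<union> snd q) = card (snd p) + card (snd q)"
      by (rule card_Un_disjoint) (use s fin VW finite_subset in auto)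
    then show ?thesis
      using D(2) D'(2) pq by (simp add: f_def add_mono)
  qed
  ultimately show ?thesis
    unfolding has_depth_def by blast
qed

section \<open>Existence of finite cone partitions\<close>

lemma upsetD: "upset V E \<Longrightarrow> e \<in> E \<Longrightarrow> t \<in> exps V \<Longrightarrow> e + t \<in> E"
  unfolding upset_def by (meson set_plus_intro subsetD)

text \<open>The apexes of a cone partition of the union generate it, and they all occur at some stage.\<close>

lemma chain_of_upsets_stabilizes:
  fixes F :: "nat \<Rightarrow> (nat \<Rightarrow>\<^sub>0 nat) set"
  assumes up: "\<And>n. upset V (F n)" and mono: "mono F" and dec: "has_depth V (\<Union>n. F n) k"
  shows "\<exists>N. \<forall>n\<ge>N. F n = F N"
proof -
  obtain D where D: "cone_decomp V (\<Union>n. F n) D"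
    using dec by (auto simp: has_depth_def)
  have "\<forall>p\<in>D. \<exists>n. fst p \<in> F n"
    using D apex_in_cone unfolding cone_decomp_def by blast
  then obtain g where g: "\<And>p. p \<in> D \<Longrightarrow> fst p \<in> F (g p)"
    by metis
  \<comment> \<open>The inserted 0 keeps the maximum meaningful when \<open>D\<close> is empty, that
    is, when all \<open>F n\<close> are empty.\<close>
  define N where "N = Max (insert 0 (g ` D))"
  have fin: "finite D"
    using D by (simp add: cone_decomp_def)
  have "F n \<subseteq> F N" for n
  proof
    fix t assume "t \<in> F n"
    then obtain p where p: "p \<in> D" "t \<in> cone p"
      using D unfolding cone_decomp_def by blast
    then obtain u where u: "u \<in> exps (snd p)" "t = fst p + u"
      by (cases p) (auto simp: in_cone)
    have sub: "snd p \<subseteq> V"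
      using D p(1) by (simp add: cone_decomp_def)
    have "g p \<le> N"
      unfolding N_def using fin p(1) by (intro Max_ge) auto
    then have "fst p \<in> F N"
      using g[OF p(1)] mono by (meson monoD subsetD)
    moreover have "u \<in> exps V"
      using u(1) exps_mono[OF sub] by blast
    ultimately show "t \<in> F N"
      using upsetD[OF up] u(2) by blast
  qed
  then show ?thesis
    using mono by (meson monoD subset_antisym)
qed

text \<open>
  Induction on the variables: slice along \<open>v\<close>. From some \<open>N\<close> on the slices are constant, and the
  corresponding part of the set is the slice at \<open>N\<close> plus a cone in the direction \<open>v\<close>.
\<close>

lemma has_depth_upset_diff:
  assumes "finite V" "upset V U" "upset V W"
  shows "has_depth V (U - W) 0"
  using assms
proof (induction V arbitrary: U W rule: finite_induct)
  case empty
  have "exps {} = {0}"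
    by (auto simp: exps_def)
  then have "U - W = {} \<or> U - W = exps {}"
    using empty by (auto simp: upset_def)
  then show ?case
    using has_depth_empty has_depth_exps has_depth_mono by (metis bot_nat_0.extremum subset_refl)
next
  case (insert v V)
  \<comment> \<open>The coefficient exponents of the \<open>n\<close>-th power of the variable
    \<open>v\<close>; these sets increase with \<open>n\<close> because \<open>E\<close> absorbs
    multiples of \<open>v\<close>.\<close>
  define slice where "slice E n = {t \<in> exps V. t + Poly_Mapping.single v n \<in> E}" for E n
  have slice_up: "upset V (slice E n)" if E: "upset (insert v V) E" for E n
    unfolding upset_def
  proof
    show "slice E n + exps V \<subseteq> slice E n"
    proof
      fix x assume "x \<in> slice E n + exps V"
      then obtain a b where ab: "x = a + b" "a \<in> slice E n" "b \<in> exps V"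
        by (auto elim: set_plus_elim)
      have "a + Poly_Mapping.single v n + b \<in> E"
        by (rule upsetD[OF E]) (use ab exps_mono[of V "insert v V"] in \<open>auto simp: slice_def\<close>)
      then show "x \<in> slice E n"
        using ab by (simp add: slice_def ac_simps)
    qed
  qed (auto simp: slice_def)
  have slice_mono: "mono (slice E)" if E: "upset (insert v V) E" for E
  proof (rule monoI, rule subsetI)
    fix m n :: nat and t assume mn: "m \<le> n" "t \<in> slice E m"
    have "t + Poly_Mapping.single v m + Poly_Mapping.single v (n - m) \<in> E"
      by (rule upsetD[OF E]) (use mn in \<open>auto simp: slice_def\<close>)
    then show "t \<in> slice E n"
      using mn by (simp add: slice_def add.assoc single_add[symmetric])
  qed
  \<comment> \<open>The induction hypothesis, applied to the union of all slices and the empty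
    upset, supplies the finite cone partition that forces the chain to stabilize.\<close>
  have stable: "\<exists>N. \<forall>n\<ge>N. slice E n = slice E N" if E: "upset (insert v V) E" for E
  proof -
    have "upset V (\<Union>n. slice E n)" "upset V {}"
      using slice_up[OF E] unfolding upset_def set_plus_def by blast+
    from insert.IH[OF this] have "has_depth V (\<Union>n. slice E n) 0"
      by simp
    then show ?thesis
      by (rule chain_of_upsets_stabilizes[OF slice_up[OF E] slice_mono[OF E]])
  qed
  obtain N1 where N1: "\<And>n. n \<ge> N1 \<Longrightarrow> slice U n = slice U N1"
    using stable[OF insert.prems(1)] by blast
  obtain N2 where N2: "\<And>n. n \<ge> N2 \<Longrightarrow> slice W n = slice W N2"
    using stable[OF insert.prems(2)] by blast
  define N where "N = max N1 N2"
  define S where "S n = slice U n - slice W n" for n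
  have S_stable: "S n = S N" if "n \<ge> N" for n
    using N1[of n] N2[of n] N1[of N] N2[of N] that by (simp add: S_def N_def)
  have S_depth: "has_depth V (S n) 0" for n
    unfolding S_def by (rule insert.IH) (use insert.prems slice_up in auto)
  have S_sub: "S n \<subseteq> exps V" for n
    by (auto simp: S_def slice_def)
  have mem_S: "t + Poly_Mapping.single v n \<in> U - W \<longleftrightarrow> t \<in> S n" if "t \<in> exps V" for t n
    using that by (auto simp: S_def slice_def)
  have split: "\<exists>t'\<in>S (Poly_Mapping.lookup t v). t = t' + Poly_Mapping.single v (Poly_Mapping.lookup t v)"
    if t: "t \<in> U - W" for t
  proof -
    have "t \<in> exps (V \<union> {v})"
      using t insert.prems by (auto simp: upset_def)
    then obtain a b where ab: "t = a + b" "a \<in> exps V" "b \<in> exps {v}"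
      unfolding exps_Un by (auto elim: set_plus_elim)
    have "Poly_Mapping.lookup t v = Poly_Mapping.lookup b v"
      using ab insert.hyps by (simp add: lookup_add lookup_exps)
    then have "b = Poly_Mapping.single v (Poly_Mapping.lookup t v)"
      using ab(3) by (intro poly_mapping_eqI) (auto simp: lookup_single when_def lookup_exps)
    then show ?thesis
      using ab t mem_S by metis
  qed
  have lookup_S: "Poly_Mapping.lookup (t + Poly_Mapping.single v m) v = m" if "t \<in> S n" for t m n
    using lookup_exps[OF subsetD[OF S_sub that] insert.hyps(2)] by (simp add: lookup_add)
  \<comment> \<open>\<open>Z = {}\<close> gives the single layer at height \<open>n\<close>,
    \<open>Z = {v}\<close> the whole tail from height \<open>n\<close> upwards.\<close>
  have layer: "has_depth (insert v V) (S n + cone (Poly_Mapping.single v n, Z)) 0"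
    if Z: "Z \<subseteq> {v}" for n Z
  proof -
    have "has_depth (V \<union> {v}) (S n + cone (Poly_Mapping.single v n, Z)) (0 + card Z)"
    proof (rule has_depth_add)
      show "has_depth {v} (cone (Poly_Mapping.single v n, Z)) (card Z)"
        by (rule has_depth_cone) (rule Z)
      show "cone (Poly_Mapping.single v n, Z) \<subseteq> exps {v}"
        using subsetD[OF exps_mono[OF Z]] by (auto simp: in_cone)
    qed (simp_all add: insert.hyps S_depth S_sub)
    then show ?thesis
      by (rule has_depth_mono) auto
  qed
  \<comment> \<open>The layers below \<open>n\<close> are finitely many and are adjoined one at a
    time.\<close>
  have low: "has_depth (insert v V) {t \<in> U - W. Poly_Mapping.lookup t v < n} 0" for n
  proof (induction n)
    case 0
    then show ?case by (simp add: has_depth_empty)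
  next
    case (Suc n)
    have "{t \<in> U - W. Poly_Mapping.lookup t v < Suc n} =
        {t \<in> U - W. Poly_Mapping.lookup t v < n} \<union> (S n + cone (Poly_Mapping.single v n, {}))"
      (is "?L = ?A \<union> ?B")
    proof -
      have B: "?B = {t + Poly_Mapping.single v n | t. t \<in> S n}"
        by (auto simp: set_plus_def in_cone exps_def)
      show ?thesis
      proof (intro equalityI subsetI)
        fix t assume t: "t \<in> ?L"
        then obtain t' where "t' \<in> S (Poly_Mapping.lookup t v)"
            "t = t' + Poly_Mapping.single v (Poly_Mapping.lookup t v)"
          using split by blast
        then show "t \<in> ?A \<union> ?B"
          unfolding B using t by (cases "Poly_Mapping.lookup t v = n") auto
      next
        fix t assume "t \<in> ?A \<union> ?B"
        then show "t \<in> ?L"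
        proof
          assume "t \<in> ?B"
          then obtain t' where t': "t' \<in> S n" "t = t' + Poly_Mapping.single v n"
            unfolding B by blast
          then show "t \<in> ?L"
            using mem_S[of t' n] S_sub lookup_S[OF t'(1), of n] by auto
        qed auto
      qed
    qed
    moreover have "?A \<inter> ?B = {}"
      using lookup_S by (fastforce simp: set_plus_def in_cone exps_def)
    ultimately show ?case
      using has_depth_Un[OF Suc layer[of "{}" n]] by simp
  qed
  have eq: "U - W = {t \<in> U - W. Poly_Mapping.lookup t v < N} \<union> (S N + cone (Poly_Mapping.single v N, {v}))"
    (is "_ = ?A \<union> ?B")
  proof -
    have B: "?B = {t + Poly_Mapping.single v n | t n. t \<in> S n \<and> n \<ge> N}"
    proof (intro equalityI subsetI)
      fix x assume "x \<in> ?B"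
      then obtain t u where tu: "x = t + (Poly_Mapping.single v N + u)" "t \<in> S N" "u \<in> exps {v}"
        by (auto simp: in_cone elim!: set_plus_elim)
      define n where "n = N + Poly_Mapping.lookup u v"
      have "Poly_Mapping.single v N + u = Poly_Mapping.single v n"
        using tu(3) by (intro poly_mapping_eqI)
          (auto simp: n_def lookup_add lookup_single when_def lookup_exps)
      then show "x \<in> {t + Poly_Mapping.single v n | t n. t \<in> S n \<and> n \<ge> N}"
        using tu(1,2) S_stable[of n] by (intro CollectI exI[of _ t] exI[of _ n]) (simp add: add.assoc n_def)
    next
      fix x assume "x \<in> {t + Poly_Mapping.single v n | t n. t \<in> S n \<and> n \<ge> N}"
      then obtain t n where tn: "x = t + Poly_Mapping.single v n" "t \<in> S n" "n \<ge> N"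
        by blast
      have "Poly_Mapping.single v n \<in> cone (Poly_Mapping.single v N, {v})"
        unfolding in_cone using tn(3)
        by (intro bexI[of _ "Poly_Mapping.single v (n - N)"]) (auto simp: single_add[symmetric])
      then show "x \<in> ?B"
        using tn S_stable[OF tn(3)] by (simp add: set_plus_intro)
    qed
    show ?thesis
    proof (intro equalityI subsetI)
      fix t assume t: "t \<in> U - W"
      then obtain t' where "t' \<in> S (Poly_Mapping.lookup t v)"
          "t = t' + Poly_Mapping.single v (Poly_Mapping.lookup t v)"
        using split by blast
      then show "t \<in> ?A \<union> ?B"
        unfolding B using t by (cases "Poly_Mapping.lookup t v < N") (blast, use not_less in blast)
    next
      fix t assume "t \<in> ?A \<union> ?B"
      then show "t \<in> U - W"
        unfolding B using mem_S S_sub by blast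
    qed
  qed
  have disj: "?A \<inter> ?B = {}"
  proof -
    have "N \<le> Poly_Mapping.lookup x v" if "x \<in> ?B" for x
      using that by (auto simp: in_cone lookup_add elim!: set_plus_elim)
    then show ?thesis
      by force
  qed
  show ?case
    by (subst eq) (rule has_depth_Un[OF low layer[OF subset_refl] disj])
qed

section \<open>Stanley decompositions of subquotients\<close>

text \<open>The span of the monomials with exponents in \<open>E\<close>: a monomial ideal if
  \<open>E\<close> is an upset, the polynomial ring itself if \<open>E = exps V\<close>.\<close>

definition supported_on :: "(nat \<Rightarrow>\<^sub>0 nat) set \<Rightarrow> 'k::field mpoly set" where
  "supported_on E = {p. Poly_Mapping.keys p \<subseteq> E}"

definition restrict_poly :: "'k::field mpoly \<Rightarrow> (nat \<Rightarrow>\<^sub>0 nat) set \<Rightarrow> 'k mpoly" where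
  "restrict_poly p S = (\<Sum>t\<in>Poly_Mapping.keys p \<inter> S. Poly_Mapping.single t (Poly_Mapping.lookup p t))"

lemma lookup_restrict_poly:
  "Poly_Mapping.lookup (restrict_poly p S) t = (if t \<in> S then Poly_Mapping.lookup p t else 0)"
  unfolding restrict_poly_def
  by (auto simp: lookup_sum lookup_single when_def in_keys_iff sum.delta)

lemma restrict_poly_supported [simp]: "restrict_poly p S \<in> supported_on S"
  by (auto simp: supported_on_def in_keys_iff lookup_restrict_poly split: if_splits)

lemma sum_monomials:
  fixes p :: "'k::field mpoly"
  shows "(\<Sum>t\<in>Poly_Mapping.keys p. Poly_Mapping.single t (Poly_Mapping.lookup p t)) = p"
  using lookup_restrict_poly[of p UNIV] unfolding restrict_poly_def
  by (intro poly_mapping_eqI) simp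

lemma supported_onI:
  "(\<And>t. t \<notin> E \<Longrightarrow> Poly_Mapping.lookup p t = 0) \<Longrightarrow> p \<in> supported_on E"
  by (auto simp: supported_on_def in_keys_iff)

lemma supported_on_lookup: "p \<in> supported_on E \<Longrightarrow> t \<notin> E \<Longrightarrow> Poly_Mapping.lookup p t = 0"
  by (auto simp: supported_on_def in_keys_iff)

lemma zero_supported [simp]: "0 \<in> supported_on E"
  by (simp add: supported_on_def)

lemma single_supported [simp]: "Poly_Mapping.single t c \<in> supported_on E \<longleftrightarrow> c = 0 \<or> t \<in> E"
  by (simp add: supported_on_def)

lemma supported_on_mono: "E \<subseteq> F \<Longrightarrow> supported_on E \<subseteq> supported_on F"
  by (auto simp: supported_on_def)

lemma add_supported: "p \<in> supported_on E \<Longrightarrow> q \<in> supported_on E \<Longrightarrow> p + q \<in> supported_on E"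
  by (auto intro!: supported_onI simp: lookup_add supported_on_lookup)

lemma diff_supported: "p \<in> supported_on E \<Longrightarrow> q \<in> supported_on E \<Longrightarrow> p - q \<in> supported_on E"
  by (auto intro!: supported_onI simp: lookup_minus supported_on_lookup)

lemma uminus_supported: "p \<in> supported_on E \<Longrightarrow> - p \<in> supported_on E"
  by (auto intro!: supported_onI simp: supported_on_lookup)

lemma sum_supported: "(\<And>i. i \<in> A \<Longrightarrow> f i \<in> supported_on E) \<Longrightarrow> sum f A \<in> supported_on E"
  by (intro supported_onI) (auto simp: lookup_sum intro!: sum.neutral intro: supported_on_lookup)

lemma mult_supported:
  "p \<in> supported_on E \<Longrightarrow> q \<in> supported_on F \<Longrightarrow> p * q \<in> supported_on (E + F)"
  unfolding supported_on_def using keys_mult[of p q] by (fastforce simp: set_plus_def)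

lemma mult_upset_supported:
  assumes "upset V E" "p \<in> supported_on (exps V)" "q \<in> supported_on E"
  shows "p * q \<in> supported_on E"
  using mult_supported[OF assms(3,2)] assms(1) supported_on_mono
  unfolding upset_def by (auto simp: mult.commute)

lemma mult_single_sum:
  fixes u :: "'k::field mpoly"
  shows "u * Poly_Mapping.single a c =
    (\<Sum>s\<in>Poly_Mapping.keys u. Poly_Mapping.single (s + a) (Poly_Mapping.lookup u s * c))"
  by (subst sum_monomials[of u, symmetric]) (simp add: sum_distrib_right mult_single)

lemma lookup_mult_single:
  fixes u :: "'k::field mpoly"
  shows "Poly_Mapping.lookup (u * Poly_Mapping.single a c) (t + a) = Poly_Mapping.lookup u t * c"
  unfolding mult_single_sum
  by (auto simp: lookup_sum lookup_single when_def in_keys_iff sum.delta)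

text \<open>Multiplication by a nonzero term shifts exponents injectively and rescales coefficients,
  so it carries K[Z] onto the span of the cone.\<close>

lemma supported_on_cone:
  assumes "c \<noteq> 0"
  shows "supported_on (cone (a, Z)) =
    (\<lambda>u. u * Poly_Mapping.single a c) ` (supported_on (exps Z) :: 'k::field mpoly set)"
proof (intro equalityI subsetI)
  fix p :: "'k mpoly" assume p: "p \<in> supported_on (cone (a, Z))"
  \<comment> \<open>The quotient of \<open>p\<close> by the term with exponent \<open>a\<close> and
    coefficient \<open>c\<close>; the truncated subtraction \<open>t - a\<close> is exact for
    \<open>t\<close> in the cone.\<close>
  define u where
    "u = (\<Sum>t\<in>Poly_Mapping.keys p. Poly_Mapping.single (t - a) (Poly_Mapping.lookup p t / c))"
  have t: "t - a \<in> exps Z \<and> (t - a) + a = t" if "t \<in> Poly_Mapping.keys p" for t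
  proof -
    have "t \<in> cone (a, Z)"
      using p that by (auto simp: supported_on_def)
    then show ?thesis
      by (auto simp: in_cone add.commute)
  qed
  have "u \<in> supported_on (exps Z)"
    unfolding u_def by (rule sum_supported) (simp add: t)
  moreover have "u * Poly_Mapping.single a c = p"
    unfolding u_def sum_distrib_right mult_single using assms
    by (subst sum_monomials[of p, symmetric]) (rule sum.cong, simp_all add: t)
  ultimately show "p \<in> (\<lambda>u. u * Poly_Mapping.single a c) ` supported_on (exps Z)"
    by blast
next
  fix p assume "p \<in> (\<lambda>u. u * Poly_Mapping.single a c) ` supported_on (exps Z)"
  then obtain u where u: "u \<in> supported_on (exps Z)" "p = u * Poly_Mapping.single a c"
    by blast
  have "u * Poly_Mapping.single a c \<in> supported_on (exps Z + {a})"
    by (rule mult_supported[OF u(1)]) simp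
  moreover have "exps Z + {a} = cone (a, Z)"
    by (auto simp: set_plus_def in_cone add.commute)
  ultimately show "p \<in> supported_on (cone (a, Z))"
    using u(2) by simp
qed

lemma carrier_mpoly_ring: "carrier (mpoly_ring V) = supported_on (exps V)"
  by (auto simp: mpoly_ring_def supported_on_def exps_def)

text \<open>
  \<open>\<pi>\<close> presents \<open>M\<close> as the quotient of the monomial ideals with exponent sets \<open>U\<close> and \<open>W\<close>; this covers
  both \<open>ideal_module\<close> (with \<open>W = {}\<close>) and \<open>quotient_module\<close>.
\<close>

locale monomial_quotient =
  fixes V :: "nat set" and U W :: "(nat \<Rightarrow>\<^sub>0 nat) set"
    and M :: "('k::field mpoly, 'm) graded_module" and \<pi> :: "'k mpoly \<Rightarrow> 'm"
  assumes upset_U: "upset V U" and upset_W: "upset V W"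
    and carrier_eq: "carrier M = \<pi> ` supported_on U"
    and zero_eq: "\<zero>\<^bsub>M\<^esub> = \<pi> 0"
    and add_eq: "\<And>u v. u \<in> supported_on U \<Longrightarrow> v \<in> supported_on U \<Longrightarrow> \<pi> u \<oplus>\<^bsub>M\<^esub> \<pi> v = \<pi> (u + v)"
    and smult_eq: "\<And>p u. p \<in> supported_on (exps V) \<Longrightarrow> u \<in> supported_on U \<Longrightarrow>
      p \<odot>\<^bsub>M\<^esub> \<pi> u = \<pi> (p * u)"
    and hcomp_eq: "\<And>\<alpha>. hcomp M \<alpha> =
      \<pi> ` {u \<in> supported_on U. \<forall>t\<in>Poly_Mapping.keys u. \<forall>v. int (Poly_Mapping.lookup t v) = \<alpha> v}"
    and eq_iff: "\<And>u v. u \<in> supported_on U \<Longrightarrow> v \<in> supported_on U \<Longrightarrow>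
      \<pi> u = \<pi> v \<longleftrightarrow> u - v \<in> supported_on W"
begin

text \<open>This makes the laws of \<open>finsum M\<close> available; they are inherited from
  addition of polynomials along \<open>\<pi>\<close>.\<close>

sublocale abelian_monoid M
proof (rule abelian_monoidI)
  fix x y z assume "x \<in> carrier M" "y \<in> carrier M" "z \<in> carrier M"
  then obtain u v w where "x = \<pi> u" "y = \<pi> v" "z = \<pi> w"
      "u \<in> supported_on U" "v \<in> supported_on U" "w \<in> supported_on U"
    unfolding carrier_eq by blast
  then show "(x \<oplus>\<^bsub>M\<^esub> y) \<oplus>\<^bsub>M\<^esub> z = x \<oplus>\<^bsub>M\<^esub> (y \<oplus>\<^bsub>M\<^esub> z)"
    by (simp add: add_eq add_supported add.assoc)
qed (auto simp: carrier_eq zero_eq add_eq add_supported add.commute)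

lemma finsum_eq:
  assumes "finite A" "\<And>i. i \<in> A \<Longrightarrow> f i \<in> supported_on U"
  shows "finsum M (\<lambda>i. \<pi> (f i)) A = \<pi> (sum f A)"
  using assms
proof (induction A rule: finite_induct)
  case empty
  then show ?case by (simp add: zero_eq)
next
  case (insert i A)
  have "finsum M (\<lambda>i. \<pi> (f i)) (insert i A) = \<pi> (f i) \<oplus>\<^bsub>M\<^esub> finsum M (\<lambda>i. \<pi> (f i)) A"
    by (rule finsum_insert) (use insert in \<open>auto simp: carrier_eq\<close>)
  then show ?case
    using insert by (simp add: add_eq sum_supported)
qed

lemma cone_subset_U:
  assumes "a \<in> U" "Z \<subseteq> V"
  shows "cone (a, Z) \<subseteq> U"
  using upsetD[OF upset_U assms(1)] subsetD[OF exps_mono[OF assms(2)]] by (auto simp: in_cone)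

lemma stanley_space_eq:
  assumes "a \<in> U" "Z \<subseteq> V" "c \<noteq> 0"
  shows "stanley_space M (\<pi> (Poly_Mapping.single a c)) Z = \<pi> ` supported_on (cone (a, Z))"
proof -
  have "u \<odot>\<^bsub>M\<^esub> \<pi> (Poly_Mapping.single a c) = \<pi> (u * Poly_Mapping.single a c)"
    if "u \<in> supported_on (exps Z)" for u
    by (rule smult_eq) (use that assms supported_on_mono[OF exps_mono[OF assms(2)]] in auto)
  then show ?thesis
    unfolding stanley_space_def supported_on_cone[OF assms(3)] carrier_mpoly_ring
    by auto (metis imageI)
qed

text \<open>Everything is read off coefficient by coefficient. Freeness keeps the cones away from
  \<open>W\<close>, uniqueness of components keeps them disjoint, and existence of components makes
  them cover \<open>U - W\<close>. Conversely, the components of an element are the restrictions of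
  a representing polynomial to the cones.\<close>

lemma stanley_decomposition_iff:
  assumes Z: "\<And>i. i \<in> {1..q} \<Longrightarrow> Z i \<subseteq> V" and a: "\<And>i. i \<in> {1..q} \<Longrightarrow> a i \<in> U"
    and c: "\<And>i. i \<in> {1..q} \<Longrightarrow> c i \<noteq> 0"
    and m: "\<And>i. i \<in> {1..q} \<Longrightarrow> m i = \<pi> (Poly_Mapping.single (a i) (c i))"
  shows "stanley_decomposition V M q m Z \<longleftrightarrow>
    disjoint_family_on (\<lambda>i. cone (a i, Z i)) {1..q} \<and> (\<Union>i\<in>{1..q}. cone (a i, Z i)) = U - W"
    (is "_ \<longleftrightarrow> ?disj \<and> ?union")
proof -
  let ?C = "\<lambda>i. cone (a i, Z i)"
  have C_U: "?C i \<subseteq> U" if "i \<in> {1..q}" for i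
    by (rule cone_subset_U) (use that a Z in auto)
  have space: "stanley_space M (m i) (Z i) = \<pi> ` supported_on (?C i)" if "i \<in> {1..q}" for i
    using stanley_space_eq[OF a Z c] m that by auto
  have smult_m: "u \<odot>\<^bsub>M\<^esub> m i = \<pi> (u * Poly_Mapping.single (a i) (c i))"
      "u * Poly_Mapping.single (a i) (c i) \<in> supported_on U"
    if "i \<in> {1..q}" "u \<in> supported_on (exps (Z i))" for i u
  proof -
    have u: "u \<in> supported_on (exps V)"
      using that supported_on_mono[OF exps_mono[OF Z]] by blast
    show "u \<odot>\<^bsub>M\<^esub> m i = \<pi> (u * Poly_Mapping.single (a i) (c i))"
      unfolding m[OF that(1)] by (rule smult_eq) (use that u a in auto)
    show "u * Poly_Mapping.single (a i) (c i) \<in> supported_on U"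
      by (rule mult_upset_supported[OF upset_U u]) (use that a in auto)
  qed
  have C_supp: "p \<in> supported_on U" if "i \<in> {1..q}" "p \<in> supported_on (?C i)" for i p
    using supported_on_mono[OF C_U] that by blast
  \<comment> \<open>Lifting each component to a polynomial supported on its cone turns the sum in
    \<open>M\<close> into the image of a sum of polynomials.\<close>
  have components: "\<exists>p. (\<forall>i\<in>{1..q}. p i \<in> supported_on (?C i) \<and> f i = \<pi> (p i)) \<and>
      finsum M f {1..q} = \<pi> (sum p {1..q}) \<and> sum p {1..q} \<in> supported_on U"
    if f: "f \<in> (\<Pi>\<^sub>E i\<in>{1..q}. stanley_space M (m i) (Z i))" for f
  proof -
    have "\<forall>i\<in>{1..q}. \<exists>p. p \<in> supported_on (?C i) \<and> f i = \<pi> p"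
      using f space by (fastforce simp: PiE_iff)
    then obtain p where p: "\<And>i. i \<in> {1..q} \<Longrightarrow> p i \<in> supported_on (?C i)"
        "\<And>i. i \<in> {1..q} \<Longrightarrow> f i = \<pi> (p i)"
      by metis
    have "finsum M f {1..q} = finsum M (\<lambda>i. \<pi> (p i)) {1..q}"
      by (rule finsum_cong') (use p(2) C_supp[OF _ p(1)] in \<open>auto simp: carrier_eq\<close>)
    also have "\<dots> = \<pi> (sum p {1..q})"
      by (rule finsum_eq) (use p C_supp in auto)
    finally have "finsum M f {1..q} = \<pi> (sum p {1..q})" .
    moreover have "sum p {1..q} \<in> supported_on U"
      by (intro sum_supported C_supp[OF _ p(1)])
    ultimately show ?thesis
      using p by (intro exI[of _ p]) simp
  qed
  show ?thesis
  proof
    assume dec: "stanley_decomposition V M q m Z"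
    \<comment> \<open>A point of the cone in \<open>W\<close> would give a monomial in the variables
      \<open>Z i\<close> that annihilates \<open>m i\<close>.\<close>
    have C_W: "?C i \<inter> W = {}" if i: "i \<in> {1..q}" for i
    proof (rule ccontr)
      assume "?C i \<inter> W \<noteq> {}"
      then obtain u where u: "u \<in> exps (Z i)" "a i + u \<in> W"
        by (auto simp: in_cone)
      have uZ: "Poly_Mapping.single u 1 \<in> supported_on (exps (Z i))"
        using u by simp
      have "Poly_Mapping.single u 1 \<odot>\<^bsub>M\<^esub> m i = \<pi> 0"
        unfolding smult_m(1)[OF i uZ]
        using smult_m(2)[OF i uZ] u by (simp add: eq_iff mult_single add.commute)
      then have "Poly_Mapping.single u (1::'k) = 0"
        using dec i uZ unfolding stanley_decomposition_def carrier_mpoly_ring zero_eq by blast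
      then show False
        by (metis lookup_single_eq lookup_zero zero_neq_one)
    qed
    have ex1: "\<exists>!f. f \<in> (\<Pi>\<^sub>E i\<in>{1..q}. stanley_space M (m i) (Z i)) \<and>
        \<pi> (Poly_Mapping.single t 1) = finsum M f {1..q}" if "t \<in> U" for t
      using dec that unfolding stanley_decomposition_def carrier_eq by simp
    have disj: "?disj"
      unfolding disjoint_family_on_def
    proof (intro ballI impI, rule ccontr)
      fix i j assume ij: "i \<in> {1..q}" "j \<in> {1..q}" "i \<noteq> j" "?C i \<inter> ?C j \<noteq> {}"
      then obtain t where t: "t \<in> ?C i" "t \<in> ?C j"
        by blast
      \<comment> \<open>\<open>F k\<close> puts the monomial x^t into the summand \<open>k\<close>
        and zero elsewhere. If \<open>t\<close> lay in two cones, this would give two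
        representations of the same element; equating them puts \<open>t\<close> into
        \<open>W\<close>, which the cones avoid.\<close>
      define F where "F k = (\<lambda>l\<in>{1..q}. \<pi> (if l = k then Poly_Mapping.single t 1 else 0))" for k
      have tU: "t \<in> U"
        using t C_U[OF ij(1)] by blast
      have F: "F k \<in> (\<Pi>\<^sub>E i\<in>{1..q}. stanley_space M (m i) (Z i)) \<and>
          \<pi> (Poly_Mapping.single t 1) = finsum M (F k) {1..q}"
        if k: "k \<in> {1..q}" "t \<in> ?C k" for k
      proof
        show "F k \<in> (\<Pi>\<^sub>E i\<in>{1..q}. stanley_space M (m i) (Z i))"
          using k by (auto simp: F_def space intro!: imageI)
        have "finsum M (F k) {1..q} =
            finsum M (\<lambda>l. \<pi> (if l = k then Poly_Mapping.single t 1 else 0)) {1..q}"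
          by (rule finsum_cong') (use tU in \<open>auto simp: F_def carrier_eq\<close>)
        also have "\<dots> = \<pi> (\<Sum>l\<in>{1..q}. if l = k then Poly_Mapping.single t 1 else 0)"
          by (rule finsum_eq) (use tU in auto)
        finally show "\<pi> (Poly_Mapping.single t 1) = finsum M (F k) {1..q}"
          using k(1) by simp
      qed
      have "F i = F j"
        using ex1[OF tU] F[OF ij(1) t(1)] F[OF ij(2) t(2)] by blast
      then have "F i i = F j i"
        by simp
      then have "\<pi> (Poly_Mapping.single t 1) = \<pi> 0"
        using ij by (simp add: F_def)
      then have "t \<in> W"
        using tU by (simp add: eq_iff)
      then show False
        using C_W[OF ij(1)] t by blast
    qed
    \<comment> \<open>The monomial x^t and the sum of its lifted components differ only on
      \<open>W\<close>, so outside \<open>W\<close> some component has a nonzero coefficient at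
      \<open>t\<close>.\<close>
    have "U - W \<subseteq> (\<Union>i\<in>{1..q}. ?C i)"
    proof
      fix t assume t: "t \<in> U - W"
      obtain f where f: "f \<in> (\<Pi>\<^sub>E i\<in>{1..q}. stanley_space M (m i) (Z i))"
          "\<pi> (Poly_Mapping.single t 1) = finsum M f {1..q}"
        using ex1 t by blast
      obtain p where p: "\<And>i. i \<in> {1..q} \<Longrightarrow> p i \<in> supported_on (?C i)"
          "finsum M f {1..q} = \<pi> (sum p {1..q})" "sum p {1..q} \<in> supported_on U"
        using components[OF f(1)] by blast
      have "Poly_Mapping.single t 1 - sum p {1..q} \<in> supported_on W"
        using eq_iff[of "Poly_Mapping.single t 1" "sum p {1..q}"] f(2) p(2,3) t by simp
      then have "Poly_Mapping.lookup (Poly_Mapping.single t 1 - sum p {1..q}) t = 0"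
        by (rule supported_on_lookup) (use t in simp)
      then have "(\<Sum>i\<in>{1..q}. Poly_Mapping.lookup (p i) t) \<noteq> 0"
        by (simp add: lookup_minus lookup_sum)
      then obtain i where i: "i \<in> {1..q}" "Poly_Mapping.lookup (p i) t \<noteq> 0"
        by (meson sum.neutral)
      then show "t \<in> (\<Union>i\<in>{1..q}. ?C i)"
        using supported_on_lookup[OF p(1)] by blast
    qed
    then show "?disj \<and> ?union"
      using disj C_U C_W by blast
  next
    assume "?disj \<and> ?union"
    then have disj: ?disj and union: ?union
      by blast+
    \<comment> \<open>By disjointness, at a point of the cone \<open>i\<close> only the summand
      \<open>i\<close> contributes.\<close>
    have lookup_sum_C: "Poly_Mapping.lookup (sum p {1..q}) t = Poly_Mapping.lookup (p i) t"
      if p: "\<And>i. i \<in> {1..q} \<Longrightarrow> p i \<in> supported_on (?C i)" and i: "i \<in> {1..q}" "t \<in> ?C i" for p i t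
    proof -
      have "Poly_Mapping.lookup (p j) t = 0" if j: "j \<in> {1..q} - {i}" for j
      proof (rule supported_on_lookup[OF p])
        show "t \<notin> ?C j"
          using disj j i unfolding disjoint_family_on_def by blast
      qed (use j in blast)
      then show ?thesis
        unfolding lookup_sum using i by (simp add: sum.remove)
    qed
    \<comment> \<open>A nonzero coefficient of an annihilator at \<open>s\<close> would put
      \<open>s + a i\<close> both into \<open>W\<close> and into a cone contained in
      \<open>U - W\<close>.\<close>
    have free: "u = 0"
      if i: "i \<in> {1..q}" and u: "u \<in> supported_on (exps (Z i))" "u \<odot>\<^bsub>M\<^esub> m i = \<pi> 0" for i u
    proof (rule poly_mapping_eqI, rule ccontr)
      fix s assume s: "Poly_Mapping.lookup u s \<noteq> Poly_Mapping.lookup 0 s"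
      have "u * Poly_Mapping.single (a i) (c i) \<in> supported_on W"
        using smult_m[OF i u(1)] u(2) eq_iff[of "u * Poly_Mapping.single (a i) (c i)" 0] by simp
      moreover have "Poly_Mapping.lookup (u * Poly_Mapping.single (a i) (c i)) (s + a i) \<noteq> 0"
        using s c[OF i] by (simp add: lookup_mult_single)
      ultimately have "s + a i \<in> W"
        using supported_on_lookup by blast
      moreover have "s \<in> exps (Z i)"
        using s supported_on_lookup[OF u(1)] by auto
      then have "s + a i \<in> ?C i"
        by (auto simp: in_cone add.commute)
      ultimately show False
        using union i by blast
    qed
    have degree: "\<exists>\<alpha>\<in>multidegrees V. m i \<in> hcomp M \<alpha>" if i: "i \<in> {1..q}" for i
    proof
      show "(\<lambda>v. int (Poly_Mapping.lookup (a i) v)) \<in> multidegrees V"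
        using a[OF i] upset_U lookup_exps by (auto simp: multidegrees_def upset_def)
      show "m i \<in> hcomp M (\<lambda>v. int (Poly_Mapping.lookup (a i) v))"
        unfolding hcomp_eq m[OF i] by (rule imageI) (use a[OF i] in simp)
    qed
    have decomp: "\<exists>!f. f \<in> (\<Pi>\<^sub>E i\<in>{1..q}. stanley_space M (m i) (Z i)) \<and> w = finsum M f {1..q}"
      if w: "w \<in> carrier M" for w
    proof -
      obtain u where u: "u \<in> supported_on U" "w = \<pi> u"
        using w by (auto simp: carrier_eq)
      \<comment> \<open>These restrictions omit only terms of \<open>u\<close> with exponents in
        \<open>W\<close>, which vanish under \<open>\<pi>\<close>.\<close>
      let ?r = "\<lambda>i. restrict_poly u (?C i)"
      have r_U: "?r i \<in> supported_on U" if "i \<in> {1..q}" for i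
        using C_supp[OF that restrict_poly_supported] .
      show ?thesis
      proof (rule ex1I)
        have "finsum M (\<lambda>i\<in>{1..q}. \<pi> (?r i)) {1..q} = finsum M (\<lambda>i. \<pi> (?r i)) {1..q}"
          by (rule finsum_cong') (use r_U in \<open>auto simp: carrier_eq\<close>)
        also have "\<dots> = \<pi> (\<Sum>i\<in>{1..q}. ?r i)"
          by (rule finsum_eq) (use r_U in auto)
        also have "\<dots> = \<pi> u"
        proof -
          have sum_U: "(\<Sum>i\<in>{1..q}. ?r i) \<in> supported_on U"
            by (intro sum_supported r_U)
          have "(\<Sum>i\<in>{1..q}. ?r i) - u \<in> supported_on W"
          proof (rule supported_onI)
            fix t assume t: "t \<notin> W"
            show "Poly_Mapping.lookup ((\<Sum>i\<in>{1..q}. ?r i) - u) t = 0"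
            proof (cases "t \<in> U")
              case True
              then obtain i where i: "i \<in> {1..q}" "t \<in> ?C i"
                using t union by blast
              have "Poly_Mapping.lookup (\<Sum>i\<in>{1..q}. ?r i) t = Poly_Mapping.lookup (?r i) t"
                by (rule lookup_sum_C[OF restrict_poly_supported i])
              then show ?thesis
                using i by (simp add: lookup_minus lookup_restrict_poly)
            next
              case False
              have "(\<Sum>i\<in>{1..q}. ?r i) - u \<in> supported_on U"
                by (rule diff_supported[OF sum_U u(1)])
              then show ?thesis
                using False by (rule supported_on_lookup)
            qed
          qed
          then show ?thesis
            by (rule eq_iff[OF sum_U u(1), THEN iffD2])
        qed
        finally have "finsum M (\<lambda>i\<in>{1..q}. \<pi> (?r i)) {1..q} = w"
          using u by simp
        then show "(\<lambda>i\<in>{1..q}. \<pi> (?r i)) \<in> (\<Pi>\<^sub>E i\<in>{1..q}. stanley_space M (m i) (Z i)) \<and>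
            w = finsum M (\<lambda>i\<in>{1..q}. \<pi> (?r i)) {1..q}"
          using space by (auto intro!: imageI)
      next
        fix f assume f: "f \<in> (\<Pi>\<^sub>E i\<in>{1..q}. stanley_space M (m i) (Z i)) \<and> w = finsum M f {1..q}"
        then obtain p where p: "\<And>i. i \<in> {1..q} \<Longrightarrow> p i \<in> supported_on (?C i)"
            "\<And>i. i \<in> {1..q} \<Longrightarrow> f i = \<pi> (p i)"
            "finsum M f {1..q} = \<pi> (sum p {1..q})" "sum p {1..q} \<in> supported_on U"
          using components by blast
        have "u - sum p {1..q} \<in> supported_on W"
          using eq_iff[OF u(1) p(4)] f p(3) u(2) by simp
        then have lookup_u: "Poly_Mapping.lookup u t = Poly_Mapping.lookup (sum p {1..q}) t"
          if "t \<notin> W" for t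
          using supported_on_lookup[OF \<open>u - sum p {1..q} \<in> supported_on W\<close> that] by (simp add: lookup_minus)
        \<comment> \<open>The cones avoid \<open>W\<close>, so on them the coefficients of any
          lifted family are determined by those of \<open>u\<close>.\<close>
        have "p i = ?r i" if i: "i \<in> {1..q}" for i
        proof (rule poly_mapping_eqI)
          fix t
          show "Poly_Mapping.lookup (p i) t = Poly_Mapping.lookup (?r i) t"
          proof (cases "t \<in> ?C i")
            case True
            then have "t \<notin> W"
              using union i by blast
            then show ?thesis
              using True lookup_u lookup_sum_C[OF p(1) i True] by (simp add: lookup_restrict_poly)
          next
            case False
            then show ?thesis
              using supported_on_lookup[OF p(1)[OF i]] by (simp add: lookup_restrict_poly)
          qed
        qed
        then show "f = (\<lambda>i\<in>{1..q}. \<pi> (?r i))"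
          using f p(2) by (auto simp: PiE_iff extensional_def fun_eq_iff)
      qed
    qed
    have carrier: "m i \<in> carrier M" if "i \<in> {1..q}" for i
      using a[OF that] m[OF that] by (simp add: carrier_eq)
    show "stanley_decomposition V M q m Z"
      unfolding stanley_decomposition_def carrier_mpoly_ring zero_eq
      by (intro conjI ballI impI) (assumption | rule carrier Z degree decomp free)+
  qed
qed

text \<open>A multidegree fixes the exponent, so a homogeneous polynomial has at most one
  term.\<close>

lemma hcomp_monomial:
  assumes "x \<in> hcomp M \<alpha>" "x \<noteq> \<pi> 0"
  shows "\<exists>a c. a \<in> U \<and> c \<noteq> 0 \<and> x = \<pi> (Poly_Mapping.single a c)"
proof -
  obtain u where u: "u \<in> supported_on U" "x = \<pi> u"
      "\<And>t v. t \<in> Poly_Mapping.keys u \<Longrightarrow> int (Poly_Mapping.lookup t v) = \<alpha> v"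
    using assms(1) unfolding hcomp_eq by blast
  have "u \<noteq> 0"
    using u assms(2) by blast
  then obtain a where a: "a \<in> Poly_Mapping.keys u"
    by (metis keys_eq_empty ex_in_conv)
  have "s = a" if "s \<in> Poly_Mapping.keys u" for s
    using u(3)[OF that] u(3)[OF a] by (intro poly_mapping_eqI) (metis of_nat_eq_iff)
  then have "Poly_Mapping.keys u = {a}"
    using a by blast
  then have "u = Poly_Mapping.single a (Poly_Mapping.lookup u a)"
    using sum_monomials[of u] by simp
  then show ?thesis
    using u(1,2) a unfolding supported_on_def by (metis in_keys_iff mem_Collect_eq subsetD)
qed

text \<open>Freeness with \<open>u = 1\<close> makes every generator nonzero, so each is the image
  of a single term and the criterion for terms applies. Only the set of all \<open>Z i\<close> has
  to be retained, since the minimum of the cardinalities depends on nothing else.\<close>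

lemma stanley_decomposition_imp_cone_decomp:
  assumes dec: "stanley_decomposition V M q m Z"
  shows "\<exists>D. cone_decomp V (U - W) D \<and> snd ` D = Z ` {1..q}"
proof -
  have nonzero: "m i \<noteq> \<pi> 0" if i: "i \<in> {1..q}" for i
  proof
    assume m0: "m i = \<pi> 0"
    have "1 \<odot>\<^bsub>M\<^esub> m i = \<pi> (1 * 0)"
      unfolding m0 by (rule smult_eq) (simp_all add: supported_on_def)
    then have "(1 :: 'k mpoly) = 0"
      using dec i unfolding stanley_decomposition_def carrier_mpoly_ring zero_eq
      by (metis (mono_tags, lifting) keys_one mem_Collect_eq mult_zero_right
          singletonD subsetI supported_on_def zero_in_exps)
    then show False
      by simp
  qed
  have "\<forall>i\<in>{1..q}. \<exists>a c. a \<in> U \<and> c \<noteq> 0 \<and> m i = \<pi> (Poly_Mapping.single a c)"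
    using dec nonzero hcomp_monomial unfolding stanley_decomposition_def by meson
  then obtain a c where ac: "\<And>i. i \<in> {1..q} \<Longrightarrow> a i \<in> U" "\<And>i. i \<in> {1..q} \<Longrightarrow> c i \<noteq> 0"
      "\<And>i. i \<in> {1..q} \<Longrightarrow> m i = \<pi> (Poly_Mapping.single (a i) (c i))"
    by metis
  have Z: "\<And>i. i \<in> {1..q} \<Longrightarrow> Z i \<subseteq> V"
    using dec unfolding stanley_decomposition_def by blast
  let ?D = "(\<lambda>i. (a i, Z i)) ` {1..q}"
  have C: "disjoint_family_on (\<lambda>i. cone (a i, Z i)) {1..q}" "(\<Union>i\<in>{1..q}. cone (a i, Z i)) = U - W"
    using stanley_decomposition_iff[of q Z a c m, OF Z ac] dec by blast+
  have "disjoint_family_on cone ?D"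
    unfolding disjoint_family_on_def
  proof (intro ballI impI)
    fix x y assume "x \<in> ?D" "y \<in> ?D" "x \<noteq> y"
    then obtain i j where "i \<in> {1..q}" "j \<in> {1..q}" "i \<noteq> j" "x = (a i, Z i)" "y = (a j, Z j)"
      by blast
    then show "cone x \<inter> cone y = {}"
      using C(1) by (simp add: disjoint_family_on_def)
  qed
  then have "cone_decomp V (U - W) ?D"
    using C(2) Z unfolding cone_decomp_def by auto
  then show ?thesis
    by (intro exI[of _ ?D]) (simp add: image_image)
qed

lemma cone_decomp_imp_stanley_decomposition:
  assumes D: "cone_decomp V (U - W) D"
  shows "\<exists>q m Z. stanley_decomposition V M q m Z \<and> Z ` {1..q} = snd ` D"
proof -
  have "finite D"
    using D by (simp add: cone_decomp_def)
  then obtain h where h: "bij_betw h {1..card D} D"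
    using ex_bij_betw_nat_finite_1 by blast
  then have hD: "h i \<in> D" if "i \<in> {1..card D}" for i
    using that by (auto simp: bij_betw_def)
  let ?a = "\<lambda>i. fst (h i)" and ?Z = "\<lambda>i. snd (h i)"
  have "stanley_decomposition V M (card D) (\<lambda>i. \<pi> (Poly_Mapping.single (?a i) 1)) ?Z"
  proof (rule stanley_decomposition_iff[where a = ?a and c = "\<lambda>_. 1", THEN iffD2])
    fix i assume i: "i \<in> {1..card D}"
    show "?Z i \<subseteq> V"
      using D hD[OF i] unfolding cone_decomp_def by blast
    have "cone (h i) \<subseteq> U - W"
      using D hD[OF i] unfolding cone_decomp_def by blast
    then show "?a i \<in> U"
      using apex_in_cone[of "h i"] by blast
  next
    have "disjoint_family_on (\<lambda>i. cone (h i)) {1..card D}"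
      unfolding disjoint_family_on_def
    proof (intro ballI impI)
      fix i j assume ij: "i \<in> {1..card D}" "j \<in> {1..card D}" "i \<noteq> j"
      have "h i \<noteq> h j"
        using inj_on_eq_iff[OF bij_betw_imp_inj_on[OF h] ij(1,2)] ij(3) by blast
      then show "cone (h i) \<inter> cone (h j) = {}"
        using D hD[OF ij(1)] hD[OF ij(2)] by (simp add: cone_decomp_def disjoint_family_on_def)
    qed
    moreover have "(\<Union>i\<in>{1..card D}. cone (h i)) = (\<Union>p\<in>h ` {1..card D}. cone p)"
      by simp
    then have "(\<Union>i\<in>{1..card D}. cone (h i)) = U - W"
      using D h unfolding cone_decomp_def bij_betw_def by metis
    ultimately show "disjoint_family_on (\<lambda>i. cone (?a i, ?Z i)) {1..card D} \<and>
        (\<Union>i\<in>{1..card D}. cone (?a i, ?Z i)) = U - W"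
      by simp
  qed simp_all
  moreover have "?Z ` {1..card D} = snd ` D"
    unfolding image_image[of snd h, symmetric] using h by (simp add: bij_betw_def)
  ultimately show ?thesis
    by blast
qed

text \<open>The maximum in \<open>sdepth\<close> is over a nonempty set of numbers bounded by
  \<open>card V\<close>, hence attained; nonemptiness comes from the existence of cone partitions.
  The form with an arbitrary \<open>k\<close> yields both upper and lower estimates.\<close>

lemma le_sdepth_iff:
  assumes "finite V" "U - W \<noteq> {}"
  shows "k \<le> sdepth V M \<longleftrightarrow> has_depth V (U - W) k"
proof -
  let ?X = "{Min ((\<lambda>i. card (Z i)) ` {1..q}) | q m Z. stanley_decomposition V M q m Z}"
  let ?Y = "{Min (card ` snd ` D) | D. cone_decomp V (U - W) D}"
  have "?X = ?Y"
  proof (intro equalityI subsetI)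
    fix x assume "x \<in> ?X"
    then obtain q m Z where x: "x = Min (card ` Z ` {1..q})" and "stanley_decomposition V M q m Z"
      by (auto simp: image_image)
    from stanley_decomposition_imp_cone_decomp[OF this(2)] x show "x \<in> ?Y"
      by (metis (mono_tags, lifting) mem_Collect_eq)
  next
    fix x assume "x \<in> ?Y"
    then obtain D where x: "x = Min (card ` snd ` D)" and "cone_decomp V (U - W) D"
      by blast
    from cone_decomp_imp_stanley_decomposition[OF this(2)]
    obtain q m Z where Z: "stanley_decomposition V M q m Z" "Z ` {1..q} = snd ` D"
      by (elim exE conjE)
    have "x = Min ((\<lambda>i. card (Z i)) ` {1..q})"
      unfolding x Z(2)[symmetric] image_image ..
    with Z(1) show "x \<in> ?X"
      by (intro CollectI exI conjI)
  qed
  then have sdepth: "sdepth V M = Max ?Y"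
    by (simp add: sdepth_def)
  \<comment> \<open>Since \<open>U - W\<close> is nonempty, so is every partition of it, and
    \<open>Min\<close> is taken over a nonempty finite set.\<close>
  have D: "finite (card ` snd ` D)" "card ` snd ` D \<noteq> {}" if "cone_decomp V (U - W) D" for D
    using that assms(2) unfolding cone_decomp_def by auto
  have "Min (card ` snd ` D) \<le> card V" if dec: "cone_decomp V (U - W) D" for D
  proof -
    obtain p where "p \<in> D"
      using D(2)[OF dec] by blast
    then have "Min (card ` snd ` D) \<le> card (snd p)"
      using D(1)[OF dec] by (intro Min_le) auto
    also have "\<dots> \<le> card V"
      using dec \<open>p \<in> D\<close> by (intro card_mono assms(1)) (auto simp: cone_decomp_def)
    finally show ?thesis .
  qed
  then have "?Y \<subseteq> {..card V}"
    by auto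
  then have fin: "finite ?Y"
    by (rule finite_subset) simp
  have "has_depth V (U - W) 0"
    by (rule has_depth_upset_diff[OF assms(1) upset_U upset_W])
  then have "?Y \<noteq> {}"
    unfolding has_depth_def by blast
  then have "k \<le> sdepth V M \<longleftrightarrow> (\<exists>y\<in>?Y. k \<le> y)"
    unfolding sdepth using fin by (simp add: Max_ge_iff)
  also have "\<dots> \<longleftrightarrow> (\<exists>D. cone_decomp V (U - W) D \<and> k \<le> Min (card ` snd ` D))"
    by blast
  also have "\<dots> \<longleftrightarrow> has_depth V (U - W) k"
  proof -
    have "k \<le> Min (card ` snd ` D) \<longleftrightarrow> (\<forall>p\<in>D. k \<le> card (snd p))"
      if "cone_decomp V (U - W) D" for D
      using Min_ge_iff[OF D[OF that], of k] by simp
    then show ?thesis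
      unfolding has_depth_def by blast
  qed
  finally show ?thesis .
qed

end

section \<open>Monomial ideals and their quotients as instances\<close>

lemma monomial_quotient_ideal_module:
  assumes "upset V U"
  shows "monomial_quotient V U {} (ideal_module (supported_on U)) id"
  using assms
  by unfold_locales (auto simp: ideal_module_def upset_def supported_on_def set_plus_def)

lemma monomial_quotient_quotient_module:
  fixes U W :: "(nat \<Rightarrow>\<^sub>0 nat) set"
  assumes U: "upset V U" and W: "upset V W" and WU: "W \<subseteq> U"
  defines "P \<equiv> (ideal_module (supported_on U) :: ('k::field mpoly, 'k mpoly) graded_module)"
  shows "monomial_quotient V U W (quotient_module P (supported_on W))
    (\<lambda>u. supported_on W +>\<^bsub>P\<^esub> u)"
proof -
  have coset: "supported_on W +>\<^bsub>P\<^esub> u = {h + u | h. h \<in> supported_on W}" for u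
    by (auto simp: P_def a_r_coset_def r_coset_def ideal_module_def)
  \<comment> \<open>This turns equalities between cosets into statements about differences of
    polynomials.\<close>
  have coset_iff: "x \<in> supported_on W +>\<^bsub>P\<^esub> u \<longleftrightarrow> x - u \<in> supported_on W" for x u
    unfolding coset by (auto intro: exI[of _ "x - u"])
  have coset_eq: "supported_on W +>\<^bsub>P\<^esub> u = supported_on W +>\<^bsub>P\<^esub> v \<longleftrightarrow> u - v \<in> supported_on W" for u v
  proof
    assume "supported_on W +>\<^bsub>P\<^esub> u = supported_on W +>\<^bsub>P\<^esub> v"
    then show "u - v \<in> supported_on W"
      using coset_iff[of u u] coset_iff[of u v] by simp
  next
    assume uv: "u - v \<in> supported_on W"
    show "supported_on W +>\<^bsub>P\<^esub> u = supported_on W +>\<^bsub>P\<^esub> v"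
    proof (rule Set.set_eqI)
      fix x
      show "x \<in> supported_on W +>\<^bsub>P\<^esub> u \<longleftrightarrow> x \<in> supported_on W +>\<^bsub>P\<^esub> v"
        using add_supported[OF _ uv, of "x - u"] diff_supported[OF _ uv, of "x - v"]
        unfolding coset_iff by auto
    qed
  qed
  show ?thesis
  proof
    show "upset V U" "upset V W"
      by fact+
    show "carrier (quotient_module P (supported_on W)) =
        (\<lambda>u. supported_on W +>\<^bsub>P\<^esub> u) ` supported_on U"
      by (simp add: quotient_module_def P_def ideal_module_def)
    show "\<zero>\<^bsub>quotient_module P (supported_on W)\<^esub> = supported_on W +>\<^bsub>P\<^esub> 0"
      using coset_iff[of _ 0] by (auto simp: quotient_module_def)
    show "(supported_on W +>\<^bsub>P\<^esub> u) \<oplus>\<^bsub>quotient_module P (supported_on W)\<^esub> (supported_on W +>\<^bsub>P\<^esub> v)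
        = supported_on W +>\<^bsub>P\<^esub> (u + v)" for u v
    proof (rule Set.set_eqI)
      fix x
      have "x \<in> (supported_on W +>\<^bsub>P\<^esub> u) \<oplus>\<^bsub>quotient_module P (supported_on W)\<^esub> (supported_on W +>\<^bsub>P\<^esub> v)
          \<longleftrightarrow> (\<exists>y z. y - u \<in> supported_on W \<and> z - v \<in> supported_on W \<and> x = y + z)"
        by (auto simp: quotient_module_def set_add_def set_mult_def P_def[symmetric] coset_iff[symmetric])
          (auto simp: P_def ideal_module_def)
      also have "\<dots> \<longleftrightarrow> x - (u + v) \<in> supported_on W"
      proof
        assume "\<exists>y z. y - u \<in> supported_on W \<and> z - v \<in> supported_on W \<and> x = y + z"
        then obtain y z where "y - u \<in> supported_on W" "z - v \<in> supported_on W" "x = y + z"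
          by blast
        then show "x - (u + v) \<in> supported_on W"
          using add_supported[of "y - u" W "z - v"] by (simp add: algebra_simps)
      next
        assume "x - (u + v) \<in> supported_on W"
        then show "\<exists>y z. y - u \<in> supported_on W \<and> z - v \<in> supported_on W \<and> x = y + z"
          by (intro exI[of _ "x - v"] exI[of _ v]) (simp add: algebra_simps)
      qed
      finally show "x \<in> (supported_on W +>\<^bsub>P\<^esub> u) \<oplus>\<^bsub>quotient_module P (supported_on W)\<^esub> (supported_on W +>\<^bsub>P\<^esub> v)
          \<longleftrightarrow> x \<in> supported_on W +>\<^bsub>P\<^esub> (u + v)"
        by (simp add: coset_iff)
    qed
    show "p \<odot>\<^bsub>quotient_module P (supported_on W)\<^esub> (supported_on W +>\<^bsub>P\<^esub> u) = supported_on W +>\<^bsub>P\<^esub> (p * u)"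
      if p: "p \<in> supported_on (exps V)" for p u
    proof -
      \<comment> \<open>Scalar multiplication is a union over all representatives; all members of
        that union coincide because \<open>supported_on W\<close> is closed under multiplication by
        \<open>p\<close>.\<close>
      have const: "supported_on W +>\<^bsub>P\<^esub> (p * x) = supported_on W +>\<^bsub>P\<^esub> (p * u)"
        if "x \<in> supported_on W +>\<^bsub>P\<^esub> u" for x
        using mult_upset_supported[OF W p, of "x - u"] that
        unfolding coset_eq coset_iff by (simp add: right_diff_distrib)
      have "u \<in> supported_on W +>\<^bsub>P\<^esub> u"
        by (simp add: coset_iff)
      then have nonempty: "supported_on W +>\<^bsub>P\<^esub> u \<noteq> {}"
        by blast
      have "p \<odot>\<^bsub>quotient_module P (supported_on W)\<^esub> (supported_on W +>\<^bsub>P\<^esub> u)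
          = (\<Union>x\<in>supported_on W +>\<^bsub>P\<^esub> u. supported_on W +>\<^bsub>P\<^esub> (p * x))"
        by (simp add: quotient_module_def P_def ideal_module_def)
      also have "\<dots> = supported_on W +>\<^bsub>P\<^esub> (p * u)"
        using nonempty const by (rule SUP_eq_const)
      finally show ?thesis .
    qed
    show "hcomp (quotient_module P (supported_on W)) \<alpha> = (\<lambda>u. supported_on W +>\<^bsub>P\<^esub> u) `
        {u \<in> supported_on U. \<forall>t\<in>Poly_Mapping.keys u. \<forall>v. int (Poly_Mapping.lookup t v) = \<alpha> v}" for \<alpha>
      by (simp add: quotient_module_def P_def ideal_module_def)
    show "supported_on W +>\<^bsub>P\<^esub> u = supported_on W +>\<^bsub>P\<^esub> v \<longleftrightarrow> u - v \<in> supported_on W" for u v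
      by (rule coset_eq)
  qed
qed

lemma le_sdepth_ideal_iff:
  assumes "finite V" "upset V U" "U \<noteq> {}"
  shows "k \<le> sdepth V (ideal_module (supported_on U :: 'k::field mpoly set)) \<longleftrightarrow> has_depth V U k"
  using monomial_quotient.le_sdepth_iff[OF monomial_quotient_ideal_module[OF assms(2)] assms(1)] assms(3)
  by simp

lemma le_sdepth_quotient_iff:
  assumes "finite V" "upset V U" "upset V W" "W \<subseteq> U" "W \<noteq> U"
  shows "k \<le> sdepth V (quotient_module (ideal_module (supported_on U)) (supported_on W :: 'k::field mpoly set))
    \<longleftrightarrow> has_depth V (U - W) k"
  using monomial_quotient.le_sdepth_iff[OF monomial_quotient_quotient_module[OF assms(2-4)] assms(1)] assms(4,5)
  by blast

section \<open>Operations on monomial ideals\<close>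

lemma cring_mpoly_ring: "cring (mpoly_ring V :: 'k::field mpoly ring)"
proof (rule cringI)
  have up: "upset V (exps V)"
    by (simp add: upset_def)
  show "abelian_group (mpoly_ring V :: 'k mpoly ring)"
  proof (rule abelian_groupI)
    fix x :: "'k mpoly" assume "x \<in> carrier (mpoly_ring V)"
    then show "\<exists>y\<in>carrier (mpoly_ring V). y \<oplus>\<^bsub>mpoly_ring V\<^esub> x = \<zero>\<^bsub>mpoly_ring V\<^esub>"
      unfolding carrier_mpoly_ring
      by (intro bexI[of _ "- x"]) (simp_all add: uminus_supported, simp add: mpoly_ring_def)
  qed (simp_all add: carrier_mpoly_ring add_supported, simp_all add: mpoly_ring_def add_supported ac_simps)
  show "comm_monoid (mpoly_ring V :: 'k mpoly ring)"
  proof (rule comm_monoidI)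
    show "\<one>\<^bsub>mpoly_ring V\<^esub> \<in> carrier (mpoly_ring V :: 'k mpoly ring)"
      by (simp add: mpoly_ring_def)
  qed (simp_all add: carrier_mpoly_ring, simp_all add: mpoly_ring_def mult_upset_supported[OF up] ac_simps)
qed (simp add: mpoly_ring_def distrib_right)

lemma ideal_supported_on:
  assumes "upset V E"
  shows "ideal (supported_on E :: 'k::field mpoly set) (mpoly_ring V)"
proof -
  interpret cring "mpoly_ring V :: 'k mpoly ring"
    by (rule cring_mpoly_ring)
  have sub: "supported_on E \<subseteq> carrier (mpoly_ring V :: 'k mpoly ring)"
    unfolding carrier_mpoly_ring by (rule supported_on_mono) (use assms in \<open>simp add: upset_def\<close>)
  \<comment> \<open>The inverse in the ring record is determined only by the group laws, so it has
    to be identified with the negative of the polynomial.\<close>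
  have minus: "\<ominus>\<^bsub>mpoly_ring V\<^esub> p = - p" if "p \<in> supported_on E" for p :: "'k mpoly"
  proof (rule minus_equality)
    show "- p \<oplus>\<^bsub>mpoly_ring V\<^esub> p = \<zero>\<^bsub>mpoly_ring V\<^esub>"
      by (simp add: mpoly_ring_def)
  qed (use that sub uminus_supported in blast)+
  show ?thesis
  proof (rule idealI[OF ring_axioms])
    show "subgroup (supported_on E) (add_monoid (mpoly_ring V :: 'k mpoly ring))"
    proof (rule add.subgroupI)
      show "\<ominus>\<^bsub>mpoly_ring V\<^esub> p \<in> supported_on E" if "p \<in> supported_on E" for p :: "'k mpoly"
        using that by (simp add: minus uminus_supported)
      show "(supported_on E :: 'k mpoly set) \<noteq> {}"
        using zero_supported by blast
    qed (use sub in \<open>auto simp: mpoly_ring_def add_supported\<close>)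
    show "x \<otimes>\<^bsub>mpoly_ring V\<^esub> p \<in> supported_on E" "p \<otimes>\<^bsub>mpoly_ring V\<^esub> x \<in> supported_on E"
      if "p \<in> supported_on E" "x \<in> carrier (mpoly_ring V)" for p x :: "'k mpoly"
      using mult_upset_supported[OF assms _ that(1), of x] that(2)
      unfolding carrier_mpoly_ring by (simp_all add: mpoly_ring_def mult.commute)
  qed
qed

lemma upset_generated: "E \<subseteq> exps V \<Longrightarrow> upset V (E + exps V)"
  unfolding upset_def by (auto simp: add.assoc elim!: set_plus_elim)

lemma upset_add: "upset V E \<Longrightarrow> upset V F \<Longrightarrow> upset V (E + F)"
  by (auto simp: upset_def elim!: set_plus_elim) (metis add.assoc set_plus_intro subsetD)

lemma upset_Un: "upset V E \<Longrightarrow> upset V F \<Longrightarrow> upset V (E \<union> F)"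
  unfolding upset_def set_plus_def by blast

lemma upset_add_exps: "upset V E \<Longrightarrow> E + exps V = E"
  unfolding upset_def by (metis add.right_neutral set_plus_intro subsetI subset_antisym zero_in_exps)

text \<open>Every monomial with exponent in \<open>E + exps V\<close> is a multiple of a monomial in
  \<open>G\<close>. Allowing \<open>G\<close> to contain other polynomials covers both generation by
  monomials and the extension of a whole ideal to a larger polynomial ring.\<close>

lemma genideal_eq_supported_on:
  fixes G :: "'k::field mpoly set"
  assumes E: "E \<subseteq> exps V" and G: "G \<subseteq> supported_on E"
    and single_G: "\<And>e. e \<in> E \<Longrightarrow> Poly_Mapping.single e 1 \<in> G"
  shows "Idl\<^bsub>mpoly_ring V\<^esub> G = supported_on (E + exps V)"
proof -
  interpret cring "mpoly_ring V :: 'k mpoly ring"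
    by (rule cring_mpoly_ring)
  have "G \<subseteq> carrier (mpoly_ring V)"
    unfolding carrier_mpoly_ring using G supported_on_mono[OF E] by blast
  then have ideal: "ideal (Idl\<^bsub>mpoly_ring V\<^esub> G) (mpoly_ring V)" and G_sub: "G \<subseteq> Idl\<^bsub>mpoly_ring V\<^esub> G"
    by (rule genideal_ideal, rule genideal_self)
  interpret Idl: ideal "Idl\<^bsub>mpoly_ring V\<^esub> G" "mpoly_ring V"
    by (rule ideal)
  show ?thesis
  proof
    show "Idl\<^bsub>mpoly_ring V\<^esub> G \<subseteq> supported_on (E + exps V)"
    proof (rule genideal_minimal[OF ideal_supported_on[OF upset_generated[OF E]]])
      have "E \<subseteq> E + exps V"
        by (metis add.right_neutral set_plus_intro subsetI zero_in_exps)
      then show "G \<subseteq> supported_on (E + exps V)"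
        using G supported_on_mono by blast
    qed
    show "supported_on (E + exps V) \<subseteq> Idl\<^bsub>mpoly_ring V\<^esub> G"
    proof
      fix p :: "'k mpoly" assume p: "p \<in> supported_on (E + exps V)"
      have monom: "Poly_Mapping.single t c \<in> Idl\<^bsub>mpoly_ring V\<^esub> G" if t: "t \<in> E + exps V" for t c
      proof -
        obtain e u where eu: "t = e + u" "e \<in> E" "u \<in> exps V"
          using t by (auto elim: set_plus_elim)
        have "Poly_Mapping.single u c \<otimes>\<^bsub>mpoly_ring V\<^esub> Poly_Mapping.single e 1 \<in> Idl\<^bsub>mpoly_ring V\<^esub> G"
          using single_G[OF eu(2)] G_sub eu(3) by (intro Idl.I_l_closed) (auto simp: carrier_mpoly_ring)
        then show ?thesis
          using eu(1) by (simp add: mpoly_ring_def mult_single add.commute)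
      qed
      have "(\<Sum>t\<in>T. Poly_Mapping.single t (Poly_Mapping.lookup p t)) \<in> Idl\<^bsub>mpoly_ring V\<^esub> G"
        if "finite T" "T \<subseteq> E + exps V" for T
        using that
      proof (induction T rule: finite_induct)
        case empty
        then show ?case
          using Idl.zero_closed by (simp add: mpoly_ring_def)
      next
        case (insert t T)
        then show ?case
          using Idl.a_closed[OF monom] by (simp add: mpoly_ring_def)
      qed
      from this[OF finite_keys[of p]] p show "p \<in> Idl\<^bsub>mpoly_ring V\<^esub> G"
        unfolding sum_monomials by (simp add: supported_on_def)
    qed
  qed
qed

lemma monomial_idealE:
  fixes I :: "'k::field mpoly set"
  assumes "monomial_ideal V I"
  obtains E where "upset V E" "I = supported_on E"
proof -
  obtain G where G: "G \<subseteq> monomials V" "I = Idl\<^bsub>mpoly_ring V\<^esub> G"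
    using assms unfolding monomial_ideal_def by blast
  define E where "E = {t. Poly_Mapping.single t 1 \<in> G}"
  have "E \<subseteq> exps V"
  proof
    fix t assume "t \<in> E"
    then obtain t' where t': "Poly_Mapping.keys t' \<subseteq> V" "Poly_Mapping.single t (1::'k) = Poly_Mapping.single t' 1"
      using G(1) unfolding E_def monomials_def by blast
    then have "t = t'"
      by (metis keys_single singleton_inject zero_neq_one)
    then show "t \<in> exps V"
      using t' by (simp add: exps_def)
  qed
  moreover have "G \<subseteq> supported_on E"
    using G(1) by (auto simp: monomials_def E_def)
  ultimately have "Idl\<^bsub>mpoly_ring V\<^esub> G = supported_on (E + exps V)"
    by (rule genideal_eq_supported_on) (simp add: E_def)
  then show ?thesis
    using that[OF upset_generated[OF \<open>E \<subseteq> exps V\<close>]] G(2) by blast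
qed

text \<open>Each monomial with exponent in \<open>E + F\<close> is itself a product of two
  monomials, and both sides are closed under addition. Thus products of monomial ideals become sum
  sets of exponents.\<close>

lemma ideal_prod_supported_on:
  "supported_on E \<cdot>\<^bsub>mpoly_ring V\<^esub> supported_on F = (supported_on (E + F) :: 'k::field mpoly set)"
proof (intro equalityI subsetI)
  fix p :: "'k mpoly" assume "p \<in> supported_on E \<cdot>\<^bsub>mpoly_ring V\<^esub> supported_on F"
  then show "p \<in> supported_on (E + F)"
    by induction (simp_all add: mpoly_ring_def mult_supported add_supported)
next
  fix p :: "'k mpoly" assume p: "p \<in> supported_on (E + F)"
  have monom: "Poly_Mapping.single t c \<in> supported_on E \<cdot>\<^bsub>mpoly_ring V\<^esub> supported_on F"
    if t: "t \<in> E + F" for t and c :: 'k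
  proof -
    obtain e f where ef: "t = e + f" "e \<in> E" "f \<in> F"
      using t by (auto elim: set_plus_elim)
    have "Poly_Mapping.single e c \<otimes>\<^bsub>mpoly_ring V\<^esub> Poly_Mapping.single f 1
        \<in> supported_on E \<cdot>\<^bsub>mpoly_ring V\<^esub> supported_on F"
      by (rule ideal_prod.prod) (simp_all add: ef)
    then show ?thesis
      using ef(1) by (simp add: mpoly_ring_def mult_single)
  qed
  \<comment> \<open>The inductive rules of \<open>ideal_prod\<close> produce only products and sums,
    so zero is obtained as a product of zeros.\<close>
  have zero: "0 \<in> supported_on E \<cdot>\<^bsub>mpoly_ring V\<^esub> (supported_on F :: 'k mpoly set)"
    using ideal_prod.prod[OF zero_supported zero_supported, of "mpoly_ring V" E F]
    by (simp add: mpoly_ring_def)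
  have "(\<Sum>t\<in>T. Poly_Mapping.single t (Poly_Mapping.lookup p t))
      \<in> supported_on E \<cdot>\<^bsub>mpoly_ring V\<^esub> supported_on F"
    if "finite T" "T \<subseteq> E + F" for T
    using that
  proof (induction T rule: finite_induct)
    case empty
    then show ?case
      by (simp add: zero)
  next
    case (insert t T)
    then show ?case
      using ideal_prod.sum[OF monom] by (simp add: mpoly_ring_def)
  qed
  from this[OF finite_keys[of p]] p show "p \<in> supported_on E \<cdot>\<^bsub>mpoly_ring V\<^esub> supported_on F"
    unfolding sum_monomials by (simp add: supported_on_def)
qed

lemma set_add_supported_on:
  "supported_on E <+>\<^bsub>mpoly_ring V\<^esub> supported_on F = (supported_on (E \<union> F) :: 'k::field mpoly set)"
proof (intro equalityI subsetI)
  fix p :: "'k mpoly" assume "p \<in> supported_on E <+>\<^bsub>mpoly_ring V\<^esub> supported_on F"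
  then obtain q r where "q \<in> supported_on E" "r \<in> supported_on F" "p = q + r"
    by (auto simp: set_add_def set_mult_def mpoly_ring_def)
  then show "p \<in> supported_on (E \<union> F)"
    using supported_on_mono[of E "E \<union> F"] supported_on_mono[of F "E \<union> F"]
    by (auto intro!: add_supported)
next
  fix p :: "'k mpoly" assume p: "p \<in> supported_on (E \<union> F)"
  \<comment> \<open>Terms with exponents in both sets go to the first summand only.\<close>
  have "p = restrict_poly p E + restrict_poly p (F - E)"
    using supported_on_lookup[OF p]
    by (intro poly_mapping_eqI) (auto simp: lookup_add lookup_restrict_poly)
  moreover have "restrict_poly p (F - E) \<in> supported_on F"
    using supported_on_mono[of "F - E" F] restrict_poly_supported by blast
  ultimately show "p \<in> supported_on E <+>\<^bsub>mpoly_ring V\<^esub> supported_on F"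
    using restrict_poly_supported[of p E]
    by (force simp: set_add_def set_mult_def mpoly_ring_def)
qed

lemma supported_on_eq_zero_iff:
  "(supported_on E :: 'k::field mpoly set) = {0} \<longleftrightarrow> E = {}"
proof
  assume E: "(supported_on E :: 'k mpoly set) = {0}"
  have "Poly_Mapping.single t (1::'k) \<in> {0}" if "t \<in> E" for t
    unfolding E[symmetric] using that by simp
  then show "E = {}"
    by (metis all_not_in_conv lookup_single_eq lookup_zero singletonD zero_neq_one)
qed (auto simp: supported_on_def)

text \<open>An element of least total degree is not a sum of two nonzero elements of
  \<open>E\<close>. This shows that a nonzero proper monomial ideal differs from its square.\<close>

lemma add_self_neq:
  assumes V: "finite V" and E: "E \<subseteq> exps V" "E \<noteq> {}" "0 \<notin> E"
  shows "E + E \<noteq> E"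
proof
  assume EE: "E + E = E"
  define d where "d t = (\<Sum>v\<in>V. Poly_Mapping.lookup t v)" for t :: "nat \<Rightarrow>\<^sub>0 nat"
  obtain e where e: "e \<in> E" "\<And>t. t \<in> E \<Longrightarrow> d e \<le> d t"
    using ex_has_least_nat[of "\<lambda>t. t \<in> E" _ d] E(2) by blast
  obtain x y where xy: "e = x + y" "x \<in> E" "y \<in> E"
    using e(1) EE by (metis set_plus_elim)
  have "d e = d x + d y"
    by (simp add: d_def xy(1) lookup_add sum.distrib)
  then have "d y = 0"
    using e(2)[OF xy(2)] by simp
  then have "Poly_Mapping.lookup y v = 0" for v
    using V E(1) xy(3) lookup_exps[of y V v] by (cases "v \<in> V") (auto simp: d_def)
  then have "y = 0"
    by (intro poly_mapping_eqI) simp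
  then show False
    using xy(3) E(3) by simp
qed

text \<open>Over disjoint variables sum sets behave like Cartesian products, by uniqueness of the
  two parts.\<close>

lemma add_mem_add_iff:
  assumes "V \<inter> W = {}" "X \<subseteq> exps V" "Y \<subseteq> exps W" "s \<in> exps V" "t \<in> exps W"
  shows "s + t \<in> X + Y \<longleftrightarrow> s \<in> X \<and> t \<in> Y"
proof
  assume "s + t \<in> X + Y"
  then obtain x y where xy: "s + t = x + y" "x \<in> X" "y \<in> Y"
    by (auto elim: set_plus_elim)
  then show "s \<in> X \<and> t \<in> Y"
    using exps_add_inject[OF assms(1,4) _ assms(5), of x y] assms(2,3) by blast
qed auto

lemma subset_add_eqI:
  assumes "S \<subseteq> A + B" "T \<subseteq> A + B"
    and "\<And>s t. s \<in> A \<Longrightarrow> t \<in> B \<Longrightarrow> s + t \<in> S \<longleftrightarrow> s + t \<in> T"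
  shows "S = T"
  using assms by (blast elim: set_plus_elim)

lemma has_depth_le_card:
  assumes "finite V" "T \<noteq> {}" "has_depth V T k"
  shows "k \<le> card V"
proof -
  obtain D where D: "cone_decomp V T D" "\<forall>p\<in>D. k \<le> card (snd p)"
    using assms(3) by (auto simp: has_depth_def)
  then obtain p where "p \<in> D"
    using assms(2) by (auto simp: cone_decomp_def)
  then have "k \<le> card (snd p)" "snd p \<subseteq> V"
    using D by (auto simp: cone_decomp_def)
  then show ?thesis
    using card_mono[OF assms(1)] by (meson order.trans)
qed

lemma Un_set_plus: "(X \<union> Y) + Z = (X + Z) \<union> (Y + Z)"
  unfolding set_plus_def by blast

lemma set_plus_Un: "Z + (X \<union> Y) = (Z + X) \<union> (Z + Y)"
  unfolding set_plus_def by blast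

section \<open>The comparison of Stanley depths\<close>

theorem proposition2p9:
  fixes r s :: nat
    and A B R :: "'k::field mpoly ring"
    and VA VB VR :: "nat set"
    and I J IR JR :: "'k mpoly set"
  assumes r: "r \<ge> 1" and s: "s \<ge> 1"
    and VA: "VA = {1..r}" and VB: "VB = {r+1..r+s}" and VR: "VR = {1..r+s}"
    and A: "A = mpoly_ring VA" and B: "B = mpoly_ring VB" and R: "R = mpoly_ring VR"
    and I: "monomial_ideal VA I" "I \<noteq> {\<zero>\<^bsub>A\<^esub>}" "I \<noteq> carrier A"
    and J: "monomial_ideal VB J" "J \<noteq> {\<zero>\<^bsub>B\<^esub>}" "J \<noteq> carrier B"
    and IR: "IR = Idl\<^bsub>R\<^esub> I" and JR: "JR = Idl\<^bsub>R\<^esub> J"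
  shows
    "(sdepth VR (quotient_module (ideal_module (carrier R)) (IR \<cdot>\<^bsub>R\<^esub> IR <+>\<^bsub>R\<^esub> IR \<cdot>\<^bsub>R\<^esub> JR))
        < sdepth VA (quotient_module (ideal_module (carrier A)) I)
          + sdepth VB (ideal_module (J \<cdot>\<^bsub>B\<^esub> J))
      \<longrightarrow>
      sdepth VR (quotient_module (ideal_module (carrier R))
                   ((IR <+>\<^bsub>R\<^esub> JR) \<cdot>\<^bsub>R\<^esub> (IR <+>\<^bsub>R\<^esub> JR)))
        \<le> sdepth VA (quotient_module (ideal_module (carrier A)) I)
          + sdepth VB (ideal_module (J \<cdot>\<^bsub>B\<^esub> J)))
     \<and>
     (sdepth VR (quotient_module (ideal_module (carrier R)) (IR \<cdot>\<^bsub>R\<^esub> IR))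
        < sdepth VA (quotient_module (ideal_module I) (I \<cdot>\<^bsub>A\<^esub> I))
          + sdepth VB (ideal_module J)
      \<longrightarrow>
      sdepth VR (quotient_module (ideal_module (carrier R)) (IR \<cdot>\<^bsub>R\<^esub> IR <+>\<^bsub>R\<^esub> IR \<cdot>\<^bsub>R\<^esub> JR))
        \<le> sdepth VR (quotient_module (ideal_module (carrier R)) (IR \<cdot>\<^bsub>R\<^esub> IR))
      \<and>
      sdepth VA (quotient_module (ideal_module (carrier A)) I)
        \<le> sdepth VA (quotient_module (ideal_module (carrier A)) (I \<cdot>\<^bsub>A\<^esub> I)))"
proof -
  have disj: "VA \<inter> VB = {}" and VR_eq: "VR = VA \<union> VB"
    using VA VB VR by auto
  have fin: "finite VA" "finite VB" "finite VR"
    using VA VB VR by auto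
  have card_VB: "card VB = s"
    using VB by simp
  obtain E where E: "upset VA E" "I = supported_on E"
    using monomial_idealE[OF I(1)] .
  obtain F where F: "upset VB F" "J = supported_on F"
    using monomial_idealE[OF J(1)] .
  let ?a = "exps VA" and ?b = "exps VB" and ?r = "exps VR"
  have r_eq: "?r = ?a + ?b"
    by (simp add: VR_eq exps_Un)
  have sub: "E \<subseteq> ?a" "F \<subseteq> ?b"
    using E(1) F(1) by (auto simp: upset_def)
  have up_exps: "upset V (exps V)" for V
    by (simp add: upset_def)
  have E_ne: "E \<noteq> {}" "E \<noteq> ?a" and F_ne: "F \<noteq> {}" "F \<noteq> ?b"
    using I(2,3) J(2,3) supported_on_eq_zero_iff
    unfolding A B E(2) F(2) carrier_mpoly_ring by (auto simp: mpoly_ring_def)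
  \<comment> \<open>If 0 were in such a set, absorption would make it the whole set of exponents,
    against properness.\<close>
  have zero: "0 \<notin> E" "0 \<notin> F"
    using upsetD[OF E(1), of 0] upsetD[OF F(1), of 0] E_ne(2) F_ne(2) sub by auto
  have up_EE: "upset VA (E + E)" and up_FF: "upset VB (F + F)"
    using E(1) F(1) by (simp_all add: upset_add)
  have EE_E: "E + E \<subseteq> E" and FF_F: "F + F \<subseteq> F"
    using E(1) F(1) sub unfolding upset_def by (meson order.refl order.trans set_plus_mono2)+
  have EE_ne: "E + E \<noteq> E"
    using add_self_neq[OF fin(1) sub(1) E_ne(1) zero(1)] .
  have Ea: "E + ?a = E" and Fb: "F + ?b = F"
    using E(1) F(1) by (simp_all add: upset_add_exps)

  \<comment> \<open>Exponent sets of the ideals in \<open>R\<close>\<close>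
  have IR_eq: "IR = supported_on (E + ?b)"
  proof -
    \<comment> \<open>All of \<open>I\<close> serves as generating set in \<open>R\<close>. As
      \<open>E\<close> absorbs \<open>?a\<close>, only the exponents \<open>?b\<close> of the new
      variables remain to be added.\<close>
    have "IR = supported_on (E + ?r)"
      unfolding IR R E(2) by (rule genideal_eq_supported_on) (use sub VR_eq exps_mono[of VA VR] in auto)
    then show ?thesis
      by (simp add: r_eq add.assoc[symmetric] Ea)
  qed
  have JR_eq: "JR = supported_on (?a + F)"
  proof -
    have "JR = supported_on (F + ?r)"
      unfolding JR R F(2) by (rule genideal_eq_supported_on) (use sub VR_eq exps_mono[of VB VR] in auto)
    also have "F + ?r = ?a + (F + ?b)"
      by (simp only: r_eq ac_simps)
    finally show ?thesis
      by (simp add: Fb)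
  qed
  have up_IR: "upset VR (E + ?b)" and up_JR: "upset VR (?a + F)"
  proof -
    have "E + ?b + ?r = (E + ?a) + (?b + ?b)" "?a + F + ?r = (?a + ?a) + (F + ?b)"
      by (simp_all only: r_eq ac_simps)
    then show "upset VR (E + ?b)" "upset VR (?a + F)"
      unfolding upset_def using sub by (simp_all add: Ea Fb r_eq set_plus_mono2)
  qed
  \<comment> \<open>\<open>P\<close>, \<open>Q\<close> and \<open>S\<close> are the exponent sets in
    \<open>R\<close> of the square of I, of IJ and of the square of J. In \<open>Q\<close> the free
    exponents are already absorbed by \<open>E\<close> and \<open>F\<close>.\<close>
  define P where "P = (E + E) + ?b"
  define Q where "Q = E + F"
  define S where "S = ?a + (F + F)"
  have PQS: "(E + ?b) + (E + ?b) = P" "(E + ?b) + (?a + F) = Q" "(?a + F) + (?a + F) = S"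
  proof -
    have "(E + ?b) + (E + ?b) = (E + E) + (?b + ?b)" "(E + ?b) + (?a + F) = (E + ?a) + (F + ?b)"
        "(?a + F) + (?a + F) = (?a + ?a) + (F + F)"
      by (simp_all only: ac_simps)
    then show "(E + ?b) + (E + ?b) = P" "(E + ?b) + (?a + F) = Q" "(?a + F) + (?a + F) = S"
      by (simp_all add: P_def Q_def S_def Ea Fb)
  qed
  have up: "upset VR P" "upset VR Q" "upset VR S"
    unfolding PQS[symmetric] using up_IR up_JR by (simp_all add: upset_add)
  have II: "IR \<cdot>\<^bsub>R\<^esub> IR = supported_on P" and IJ: "IR \<cdot>\<^bsub>R\<^esub> JR = supported_on Q"
    unfolding R IR_eq JR_eq ideal_prod_supported_on PQS by (rule refl)+
  have IIJ: "IR \<cdot>\<^bsub>R\<^esub> IR <+>\<^bsub>R\<^esub> IR \<cdot>\<^bsub>R\<^esub> JR = supported_on (P \<union> Q)"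
    unfolding II IJ unfolding R set_add_supported_on ..
  have sum_sq: "(IR <+>\<^bsub>R\<^esub> JR) \<cdot>\<^bsub>R\<^esub> (IR <+>\<^bsub>R\<^esub> JR) = supported_on (P \<union> Q \<union> S)"
  proof -
    have "((E + ?b) \<union> (?a + F)) + ((E + ?b) \<union> (?a + F)) = P \<union> Q \<union> S"
      unfolding Un_set_plus set_plus_Un PQS add.commute[of "?a + F" "E + ?b"] by blast
    then show ?thesis
      unfolding R IR_eq JR_eq set_add_supported_on ideal_prod_supported_on by simp
  qed
  have II_A: "I \<cdot>\<^bsub>A\<^esub> I = supported_on (E + E)" and JJ_B: "J \<cdot>\<^bsub>B\<^esub> J = supported_on (F + F)"
    unfolding A B E(2) F(2) ideal_prod_supported_on by (rule refl)+
  have carriers: "carrier A = supported_on ?a" "carrier R = supported_on ?r"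
    unfolding A R carrier_mpoly_ring by (rule refl)+

  note mem = add_mem_add_iff[OF disj]
  \<comment> \<open>Membership of a monomial of \<open>R\<close> is decided by its
    \<open>A\<close>-part and its \<open>B\<close>-part, which reduces the partitions below to
    propositional checks.\<close>
  have mem_PQS: "x + y \<in> P \<longleftrightarrow> x \<in> E + E" "x + y \<in> Q \<longleftrightarrow> x \<in> E \<and> y \<in> F" "x + y \<in> S \<longleftrightarrow> y \<in> F + F"
    if "x \<in> ?a" "y \<in> ?b" for x y
    unfolding P_def Q_def S_def using that sub up_EE up_FF by (auto simp: mem upset_def)
  have zero_PQS: "0 \<notin> P" "0 \<notin> Q" "0 \<notin> S"
    using mem_PQS[of 0 0] zero EE_E FF_F by auto
  have sub_r: "P \<subseteq> ?r" "Q \<subseteq> ?r" "S \<subseteq> ?r"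
    using up by (auto simp: upset_def)
  \<comment> \<open>The monomial 1 lies in none of these ideals, so the quotients are nonzero and
    their depths meaningful.\<close>
  have ne: "P \<noteq> ?r" "P \<union> Q \<noteq> ?r" "P \<union> Q \<union> S \<noteq> ?r"
    using zero_PQS zero_in_exps[of VR] by blast+

  \<comment> \<open>The maximum is attained: this is the characterization with \<open>k\<close>
    equal to the depth itself.\<close>
  have depth: "has_depth V (U - W) (sdepth V (quotient_module (ideal_module (supported_on U)) (supported_on W :: 'k mpoly set)))"
    if "finite V" "upset V U" "upset V W" "W \<subseteq> U" "W \<noteq> U" for V U W
    using le_sdepth_quotient_iff[OF that, where 'k = 'k] by blast
  have depth_ideal: "has_depth V U (sdepth V (ideal_module (supported_on U :: 'k mpoly set)))"
    if "finite V" "upset V U" "U \<noteq> {}" for V U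
    using le_sdepth_ideal_iff[OF that, where 'k = 'k] by blast

  \<comment> \<open>The Stanley depths as depths of exponent sets\<close>
  let ?sAI = "sdepth VA (quotient_module (ideal_module (carrier A)) I)"
  let ?sAII = "sdepth VA (quotient_module (ideal_module (carrier A)) (I \<cdot>\<^bsub>A\<^esub> I))"
  let ?sIII = "sdepth VA (quotient_module (ideal_module I) (I \<cdot>\<^bsub>A\<^esub> I))"
  let ?sJ = "sdepth VB (ideal_module J)"
  let ?sJJ = "sdepth VB (ideal_module (J \<cdot>\<^bsub>B\<^esub> J))"
  let ?sRII = "sdepth VR (quotient_module (ideal_module (carrier R)) (IR \<cdot>\<^bsub>R\<^esub> IR))"
  let ?sRIJ = "sdepth VR (quotient_module (ideal_module (carrier R)) (IR \<cdot>\<^bsub>R\<^esub> IR <+>\<^bsub>R\<^esub> IR \<cdot>\<^bsub>R\<^esub> JR))"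
  let ?sRsq = "sdepth VR (quotient_module (ideal_module (carrier R)) ((IR <+>\<^bsub>R\<^esub> JR) \<cdot>\<^bsub>R\<^esub> (IR <+>\<^bsub>R\<^esub> JR)))"

  have dAI: "has_depth VA (?a - E) ?sAI"
    unfolding carriers E(2) by (rule depth[OF fin(1) up_exps E(1) sub(1) E_ne(2)])
  have EE_a: "E + E \<subseteq> ?a" "E + E \<noteq> ?a"
    using EE_E sub(1) E_ne(2) by blast+
  have dAII: "has_depth VA (?a - (E + E)) ?sAII"
    unfolding carriers II_A by (rule depth[OF fin(1) up_exps up_EE EE_a])
  have dIII: "has_depth VA (E - (E + E)) ?sIII"
    unfolding II_A unfolding E(2) by (rule depth[OF fin(1) E(1) up_EE EE_E EE_ne])
  have dJ: "has_depth VB F ?sJ"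
    unfolding F(2) by (rule depth_ideal[OF fin(2) F(1) F_ne(1)])
  have FF_ne: "F + F \<noteq> {}"
    using F_ne(1) set_plus_intro by blast
  have dJJ: "has_depth VB (F + F) ?sJJ"
    unfolding JJ_B by (rule depth_ideal[OF fin(2) up_FF FF_ne])
  have dRIJ: "has_depth VR (?r - (P \<union> Q)) ?sRIJ"
    unfolding carriers IIJ
    by (rule depth[OF fin(3) up_exps _ _ ne(2)]) (use up sub_r in \<open>simp_all add: upset_Un\<close>)
  have dRsq: "has_depth VR (?r - (P \<union> Q \<union> S)) ?sRsq"
    unfolding carriers sum_sq
    by (rule depth[OF fin(3) up_exps _ _ ne(3)]) (use up sub_r in \<open>simp_all add: upset_Un\<close>)
  have le_RIJ: "k \<le> ?sRIJ" if "has_depth VR (?r - (P \<union> Q)) k" for k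
    unfolding carriers IIJ
    by (rule le_sdepth_quotient_iff[OF fin(3) up_exps _ _ ne(2), THEN iffD2])
      (use up sub_r that in \<open>simp_all add: upset_Un\<close>)
  have le_RII: "k \<le> ?sRII" if "has_depth VR (?r - P) k" for k
    unfolding carriers II
    by (rule le_sdepth_quotient_iff[OF fin(3) up_exps up(1) sub_r(1) ne(1), THEN iffD2]) (rule that)
  have le_AII: "k \<le> ?sAII" if "has_depth VA (?a - (E + E)) k" for k
    unfolding carriers II_A
    by (rule le_sdepth_quotient_iff[OF fin(1) up_exps up_EE EE_a, THEN iffD2]) (rule that)

  have tensor: "has_depth VR (X + Y) (k + l)"
    if "has_depth VA X k" "X \<subseteq> ?a" "has_depth VB Y l" "Y \<subseteq> ?b" for X Y k l
    unfolding VR_eq using that by (rule has_depth_add[OF fin(1,2) disj])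
  \<comment> \<open>Cutting a set of exponents in two is the combinatorial form of a short exact
    sequence; the depth of the middle is at least the minimum of the outer depths.\<close>
  have exact: "has_depth V T (min k l)"
    if "has_depth V T' k" "has_depth V T'' l" "T = T' \<union> T''" "T' \<inter> T'' = {}" for V T T' T'' k l
    unfolding that(3) by (rule has_depth_Un[OF _ _ that(4)]; rule has_depth_mono) (use that in auto)

  show ?thesis
  proof (intro conjI impI)
    assume less: "?sRIJ < ?sAI + ?sJJ"
    have "has_depth VR (?r - (P \<union> Q)) (min ?sRsq (?sAI + ?sJJ))"
    proof (rule exact[OF dRsq tensor[OF dAI _ dJJ]])
      show FF: "F + F \<subseteq> ?b"
        using FF_F sub(2) by blast
      \<comment> \<open>A monomial of \<open>S\<close> outside \<open>Q\<close> has its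
        \<open>A\<close>-part outside \<open>E\<close>, since its \<open>B\<close>-part lies in
        \<open>F + F\<close> and hence in \<open>F\<close>. Conversely, an \<open>A\<close>-part
        outside \<open>E\<close> excludes both \<open>P\<close> and \<open>Q\<close>.\<close>
      show "?r - (P \<union> Q) = (?r - (P \<union> Q \<union> S)) \<union> ((?a - E) + (F + F))"
        unfolding r_eq
      proof (rule subset_add_eqI)
        show "(?a + ?b - (P \<union> Q \<union> S)) \<union> ((?a - E) + (F + F)) \<subseteq> ?a + ?b"
          using FF by (simp add: Diff_subset set_plus_mono2 le_supI)
        fix x y assume xy: "x \<in> ?a" "y \<in> ?b"
        then show "x + y \<in> ?a + ?b - (P \<union> Q) \<longleftrightarrow>
            x + y \<in> (?a + ?b - (P \<union> Q \<union> S)) \<union> ((?a - E) + (F + F))"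
          using FF EE_E FF_F by (auto simp: mem mem_PQS)
      qed auto
      show "(?r - (P \<union> Q \<union> S)) \<inter> ((?a - E) + (F + F)) = {}"
        unfolding S_def by (auto elim!: set_plus_elim)
    qed auto
    \<comment> \<open>The minimum is at most \<open>?sRIJ\<close>, which lies strictly below
      \<open>?sAI + ?sJJ\<close>; so the minimum is \<open>?sRsq\<close>.\<close>
    with le_RIJ less show "?sRsq \<le> ?sAI + ?sJJ"
      by fastforce
  next
    assume less: "?sRII < ?sIII + ?sJ"
    have "has_depth VR (?r - P) (min ?sRIJ (?sIII + ?sJ))"
    proof (rule exact[OF dRIJ tensor[OF dIII _ dJ sub(2)]])
      show E': "E - (E + E) \<subseteq> ?a"
        using sub(1) by blast
      \<comment> \<open>What \<open>Q\<close> adds to \<open>P\<close> are the monomials with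
        \<open>A\<close>-part in \<open>E - (E + E)\<close> and \<open>B\<close>-part in
        \<open>F\<close>.\<close>
      show "?r - P = (?r - (P \<union> Q)) \<union> ((E - (E + E)) + F)"
        unfolding r_eq
      proof (rule subset_add_eqI)
        show "(?a + ?b - (P \<union> Q)) \<union> ((E - (E + E)) + F) \<subseteq> ?a + ?b"
          using E' sub(2) by (simp add: Diff_subset set_plus_mono2 le_supI)
        fix x y assume xy: "x \<in> ?a" "y \<in> ?b"
        then show "x + y \<in> ?a + ?b - P \<longleftrightarrow> x + y \<in> (?a + ?b - (P \<union> Q)) \<union> ((E - (E + E)) + F)"
          using E' sub(2) by (auto simp: mem mem_PQS)
      qed auto
      show "(?r - (P \<union> Q)) \<inter> ((E - (E + E)) + F) = {}"
        unfolding Q_def by (auto elim!: set_plus_elim)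
    qed
    with le_RII less show "?sRIJ \<le> ?sRII"
      by fastforce
    \<comment> \<open>Adjoining the variables of \<open>B\<close> freely raises the depth by their
      number: the second factor is the single full cone \<open>?b\<close>.\<close>
    have "has_depth VR (?r - P) (?sAII + card VB)"
    proof -
      have "?r - P = (?a - (E + E)) + ?b"
        unfolding r_eq
        by (rule subset_add_eqI[OF Diff_subset set_plus_mono2[OF Diff_subset subset_refl]])
          (auto simp: mem mem_PQS)
      then show ?thesis
        using tensor[OF dAII _ has_depth_exps] by simp
    qed
    then have "?sAII + s \<le> ?sRII"
      using le_RII card_VB by simp
    moreover have "?sJ \<le> s"
      using has_depth_le_card[OF fin(2) F_ne(1) dJ] card_VB by simp
    \<comment> \<open>The chain is
      \<open>?sAII + s \<le> ?sRII < ?sIII + ?sJ \<le> ?sIII + s\<close>.\<close>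
    ultimately have "?sAII < ?sIII"
      using less by linarith
    \<comment> \<open>The monomials outside the square of I are those outside I together with those
      of I outside its square. As \<open>?sAII\<close> is below \<open>?sIII\<close>, the minimum
      must be \<open>?sAI\<close>.\<close>
    moreover have "has_depth VA (?a - (E + E)) (min ?sAI ?sIII)"
      by (rule exact[OF dAI dIII]) (use EE_E sub(1) in auto)
    ultimately show "?sAI \<le> ?sAII"
      using le_AII by fastforce
  qed
qed

end
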